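(* Let $r\ge1$, let $n_1,\dots,n_r$ be non-negative integers, $\mathbf n=(n_1,\dots,n_r)$, and let $a,b,c,d,x_1,\dots,x_r$ be generic nonzero complex parameters. Then $$\sum_{\substack{0\le k_i\le n_i\\ i=1,\dots,r}}\frac{\Delta(\mathbf xq^{\mathbf k};p)}{\Delta(\mathbf x;p)}\frac{\theta(aq^{2|\mathbf k|};p)}{\theta(a;p)}\frac{(a,b,c;q,p)_{|\mathbf k|}}{(aq^{|\mathbf n|+1},aq/b,aq/c;q,p)_{|\mathbf k|}}q^{|\mathbf k|}\prod_{i,j=1}^r\frac{(q^{-n_j}x_i/x_j;q,p)_{k_i}}{(qx_i/x_j;q,p)_{k_i}}$$ $$\times\prod_{i=1}^r\frac{(bcd/ax_i;q,p)_{|\mathbf k|-k_i}\,(d/x_i;q,p)_{|\mathbf k|}\,(a^2x_iq^{|\mathbf n|+1}/bcd;q,p)_{k_i}}{(d/x_i;q,p)_{|\mathbf k|-k_i}\,(bcdq^{-n_i}/ax_i;q,p)_{|\mathbf k|}\,(ax_iq/d;q,p)_{k_i}}$$ $$=\frac{(aq,aq/bc;q,p)_{|\mathbf n|}}{(aq/b,aq/c;q,p)_{|\mathbf n|}}\prod_{i=1}^r\frac{(ax_iq/bd,ax_iq/cd;q,p)_{n_i}}{(ax_iq/d,ax_iq/bcd;q,p)_{n_i}}.$$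
   Context: $p,q$ are complex numbers with $|p|<1$, $q\ne0$, and $q^k\notin p^{\mathbb Z}$ for all integers $k>0$ (if $p=0$: $q^k\ne1$). For $x\ne0$, $\theta(x;p)=\prod_{j=0}^\infty(1-p^jx)(1-p^{j+1}/x)$. Elliptic shifted factorials: $(a;q,p)_k=\prod_{j=0}^{k-1}\theta(aq^j;p)$ for $k\in\mathbb Z_{\ge0}$, and $(a_1,\dots,a_m;q,p)_k=(a_1;q,p)_k\cdots(a_m;q,p)_k$. For $\mathbf k=(k_1,\dots,k_r)$, $|\mathbf k|=k_1+\cdots+k_r$. For $\mathbf x=(x_1,\dots,x_r)$, $\Delta(\mathbf x;p)=\prod_{1\le i<j\le r}x_j\theta(x_i/x_j;p)$, and $\mathbf xq^{\mathbf k}=(x_1q^{k_1},\dots,x_rq^{k_r})$. In expressions such as $bcd/ax_i$, everything after the slash is in the denominator. All parameters are assumed generic so that no denominator vanishes. *)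

theory Defs
  imports "HOL-Analysis.Analysis"
begin

definition theta :: "complex \<Rightarrow> complex \<Rightarrow> complex" where
  "theta x p = (\<Prod>j. (1 - p ^ j * x) * (1 - p ^ (j + 1) / x))"

text \<open>The product converges for every nome in the unit disc, also when some factor vanishes, so
  \<^const>\<open>prodinf\<close> is its genuine value (and equals \<open>1 - x\<close> for \<open>p = 0\<close>, as \<open>0 ^ 0 = 1\<close>).\<close>

lemma theta_has_prod:
  assumes "norm p < 1"
  shows "(\<lambda>j. (1 - p ^ j * x) * (1 - p ^ (j + 1) / x)) has_prod theta x p"
proof -
  have s: "summable (\<lambda>j. norm (p ^ j * y))" for y
    using assms by (simp add: norm_mult norm_power summable_mult2 summable_geometric)
  have c: "convergent_prod (\<lambda>j. 1 - p ^ j * y)" for y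
    using s[of y]
    by (intro abs_convergent_prod_imp_convergent_prod) (simp add: abs_convergent_prod_conv_summable)
  have "convergent_prod (\<lambda>j. (1 - p ^ j * x) * (1 - p ^ j * (p / x)))"
    by (intro convergent_prod_mult c)
  then have "convergent_prod (\<lambda>j. (1 - p ^ j * x) * (1 - p ^ (j + 1) / x))"
    by (simp add: mult.commute)
  then show ?thesis
    unfolding theta_def by (rule convergent_prod_has_prod)
qed

definition ell_fact :: "complex \<Rightarrow> complex \<Rightarrow> complex \<Rightarrow> nat \<Rightarrow> complex" where
  "ell_fact a q p k = (\<Prod>j<k. theta (a * q ^ j) p)"

definition ell_facts :: "complex list \<Rightarrow> complex \<Rightarrow> complex \<Rightarrow> nat \<Rightarrow> complex" where
  "ell_facts as q p k = prod_list (map (\<lambda>a. ell_fact a q p k) as)"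

text \<open>A vector with \<open>r\<close> entries is a function on \<^typ>\<open>nat\<close> of which only the values on \<open>{1..r}\<close> are
  used.\<close>

definition Delta :: "nat \<Rightarrow> (nat \<Rightarrow> complex) \<Rightarrow> complex \<Rightarrow> complex" where
  "Delta r x p = (\<Prod>j\<in>{1..r}. \<Prod>i\<in>{1..<j}. x j * theta (x i / x j) p)"

definition vsum :: "nat \<Rightarrow> (nat \<Rightarrow> nat) \<Rightarrow> nat" where
  "vsum r k = (\<Sum>i\<in>{1..r}. k i)"

text \<open>The multi-indices with \<open>0 \<le> k\<^sub>i \<le> n\<^sub>i\<close>; entries outside \<open>{1..r}\<close> are pinned by \<^const>\<open>PiE\<close>, so
  each multi-index occurs exactly once.\<close>

definition index_box :: "nat \<Rightarrow> (nat \<Rightarrow> nat) \<Rightarrow> (nat \<Rightarrow> nat) set" where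
  "index_box r n = (\<Pi>\<^sub>E i\<in>{1..r}. {0..n i})"

end

theory Submission
  imports Defs "HOL-Complex_Analysis.Complex_Analysis"
begin

text \<open>
  Put \<open>A = aq/d\<close>, \<open>B = aq/(bcd)\<close>, \<open>K = bc = A/B\<close>. With \<open>d\<close> replaced by \<open>A\<close> and \<open>c\<close> by \<open>K/b\<close>, the
  right-hand side is, up to a factor independent of \<open>b\<close>, a product of factors
  \<open>\<theta>(Au/b) \<theta>(Bub)\<close> over the points \<open>u = x\<^sub>i q\<^sup>s\<close>, \<open>0 \<le> s < n\<^sub>i\<close>, divided by
  \<open>(aq/b, aq/c)\<close>; the left-hand side expands this product in the functions
  \<open>(b, c)\<^sub>N (aq\<^bsup>N+1\<^esup>/b, aq\<^bsup>N+1\<^esup>/c)\<^bsub>|n|-N\<^esub>\<close> of \<open>b\<close>.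

  For arbitrary points the expansion coefficients are sums over subsets \<open>S\<close> of the set of points.
  This is proved by adding one point \<open>z\<close> at a time, while \<open>a\<close> becomes \<open>aq\<close> for the smaller set:
  each term is expanded into elliptic partial fractions in \<open>z\<close>, the residues of \<open>S\<close> cancel against
  those of \<open>S - {i}\<close>, and the remaining parts match by the addition formula of Weierstrass. The
  genericity used in the division is removed by continuity. For the points \<open>x\<^sub>i q\<^sup>s\<close> only the sets
  \<open>{(i, s). s < k\<^sub>i}\<close> contribute, because \<open>\<theta>(1) = 0\<close>, and their terms are those of the theorem.
\<close>

text \<open>Fix \<open>K = bc\<close>. As functions of \<open>b\<close>, the products \<theta>(Az/b)
  \<theta>(Bzb), \<theta>(aq^(N+1)/b) \<theta>(aq^(N+1)/c) and \<theta>(bq^N) \<theta>(cq^N) are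
  theta pairs with the same constant \<open>K\<close>, hence linearly dependent. The basis function
  with index \<open>N\<close> for \<open>aq\<close> and \<open>M\<close> points is the common factor
  of those with indices \<open>N\<close> and \<open>N + 1\<close> for \<open>a\<close> and
  \<open>M + 1\<close> points. This is why \<open>a\<close> turns into \<open>aq\<close>, and why
  the factor of a new point \<open>w\<close> couples only \<open>S\<close> and \<open>S\<close> with
  \<open>w\<close> added. The obstacle is that these two terms also contain the interaction of
  \<open>z\<close> with all the old points, which no three-term relation removes. Each is therefore
  divided by one more factor \<theta>(kz) and expanded with poles at the old points and at
  \<open>1/k\<close>, where \<open>k\<close> is chosen so that the pole at \<open>1/k\<close> yields
  exactly the term for the old points and \<open>aq\<close>. The same choices give the terms of
  \<open>S\<close> with \<open>i\<close> added and of \<open>S\<close> with \<open>w\<close> added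
  the same kernel parameter aq^(2(|S|+1)), so their parts with pole at \<open>x i\<close> agree up
  to sign.\<close>

section \<open>Preliminaries from analysis and combinatorics\<close>

lemma eq_zero_if_zero_off_countable:
  fixes f :: "complex \<Rightarrow> complex"
  assumes "isCont f w" and "countable B" and "\<And>z. z \<notin> B \<Longrightarrow> f z = 0"
  shows "f w = 0"
proof (rule ccontr)
  assume "f w \<noteq> 0"
  then have "eventually (\<lambda>z. f z \<noteq> 0) (at w)"
    using assms(1) unfolding isCont_def by (intro tendsto_imp_eventually_ne) auto
  then have "eventually (\<lambda>z. f z \<noteq> 0) (nhds w)"
    using \<open>f w \<noteq> 0\<close> by (auto simp: eventually_at_filter elim!: eventually_mono)
  then obtain e where e: "e > 0" "\<And>z. dist z w < e \<Longrightarrow> f z \<noteq> 0"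
    by (auto simp: eventually_nhds_metric)
  \<comment> \<open>The exceptional sets below are countable unions of zero sets of theta functions,
    and a ball is uncountable; this settles every continuity argument.\<close>
  have "ball w e \<subseteq> B"
    using e(2) assms(3) by (force simp: dist_commute)
  then show False
    using uncountable_ball[OF e(1)] assms(2) countable_subset by blast
qed

text \<open>The singularities are removable because each zero of \<open>E\<close> is simple and
  shared by \<open>D\<close>; the \<open>if\<close> supplies the limit of the quotient there. It
  prepares the quotient for Liouville's theorem.\<close>

lemma holomorphic_quotient:
  assumes hol: "D holomorphic_on S" "E holomorphic_on S" and S: "open S"
    and zeros: "\<And>z. z \<in> S \<Longrightarrow> E z = 0 \<Longrightarrow> D z = 0 \<and> deriv E z \<noteq> 0"
  shows "(\<lambda>z. if E z = 0 then deriv D z / deriv E z else D z / E z) holomorphic_on S"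
    (is "?h holomorphic_on S")
proof -
  have "?h analytic_on {a}" if "a \<in> S" for a
  proof -
    have E_der: "(E has_field_derivative deriv E a) (at a)" and D_der: "(D has_field_derivative
        deriv D a) (at a)"
      using holomorphic_derivI[OF _ S that] hol by auto
    have ev: "eventually (\<lambda>z. E z \<noteq> 0) (at a)"
    proof (cases "E a = 0")
      case True
      have "((\<lambda>z. (E z - E a) / (z - a)) \<longlongrightarrow> deriv E a) (at a)"
        using E_der by (simp add: has_field_derivative_iff)
      then have "eventually (\<lambda>z. (E z - E a) / (z - a) \<noteq> 0) (at a)"
        using zeros[OF that True] by (intro tendsto_imp_eventually_ne) auto
      then show ?thesis by eventually_elim (use True in auto)
    next
      case False
      have "(E \<longlongrightarrow> E a) (at a)" using E_der DERIV_isCont isCont_def by blast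
      then show ?thesis using False by (intro tendsto_imp_eventually_ne)
    qed
    moreover have "eventually (\<lambda>z. z \<in> S) (at a)" using S that by (rule eventually_at_in_open')
    ultimately have "eventually (\<lambda>z. E z \<noteq> 0 \<and> z \<in> S) (at a)" by eventually_elim auto
    then obtain r where r: "r > 0" "\<And>z. z \<noteq> a \<Longrightarrow> dist z a < r \<Longrightarrow> E z \<noteq> 0 \<and> z \<in> S"
      by (auto simp: eventually_at)
    have sub: "ball a r \<subseteq> S" using r(2) that by (force simp: dist_commute)
    have "?h holomorphic_on ball a r"
    proof (rule no_isolated_singularity'[where K = "{a}"])
      have "(\<lambda>z. D z / E z) holomorphic_on (ball a r - {a})"
        using r(2) sub by (intro holomorphic_intros holomorphic_on_subset[OF hol(1)]
            holomorphic_on_subset[OF hol(2)])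
          (auto simp: dist_commute)
      then show "?h holomorphic_on (ball a r - {a})"
        by (rule holomorphic_transform) (use r(2) in \<open>auto simp: dist_commute\<close>)
      have "(?h \<longlongrightarrow> ?h a) (at a)"
      proof (cases "E a = 0")
        case True
        then have D0: "D a = 0" "deriv E a \<noteq> 0" using zeros that by auto
        have "((\<lambda>z. ((D z - D a) / (z - a)) / ((E z - E a) / (z
            - a))) \<longlongrightarrow> deriv D a / deriv E a) (at a)"
          using D_der E_der D0(2) by (intro tendsto_divide) (auto simp: has_field_derivative_iff)
        moreover have "eventually (\<lambda>z. ((D z - D a) / (z - a)) / ((E z - E a) / (z - a)) =
            ?h z) (at a)"
          using ev eventually_neq_at_within[of a a UNIV]
          by eventually_elim (auto simp: True D0)
        ultimately show ?thesis using True by (simp add: tendsto_cong)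
      next
        case False
        have "(D \<longlongrightarrow> D a) (at a)" "(E \<longlongrightarrow> E a) (at a)"
          using D_der E_der DERIV_isCont isCont_def by blast+
        then have "((\<lambda>z. D z / E z) \<longlongrightarrow> D a / E a) (at a)" using False by (intro tendsto_divide)
        moreover have "eventually (\<lambda>z. D z / E z = ?h z) (at a)"
          using ev by eventually_elim auto
        ultimately show ?thesis using False by (simp add: tendsto_cong)
      qed
      then show "(?h \<longlongrightarrow> ?h z) (at z within ball a r)" if "z \<in> {a}" for z
        using that by (auto intro: tendsto_within_subset)
    qed auto
    then show ?thesis using r(1) by (auto simp: analytic_at_ball)
  qed
  then show ?thesis
    using analytic_on_analytic_at analytic_imp_holomorphic by blast
qed

text \<open>Moving \<open>i\<close> out of \<open>S\<close> is a bijection from the pairs with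
  \<open>i \<in> S\<close> to those with \<open>i \<in> X - S\<close>. In this form the residues
  cancel in \<open>product_expansion_generic\<close>.\<close>

lemma sum_Pow_swap:
  assumes "finite X"
  shows "(\<Sum>S\<in>Pow X. \<Sum>i\<in>S. F (S - {i}) i) = (\<Sum>S\<in>Pow X. \<Sum>i\<in>X - S. F S i)"
proof -
  have "(\<Sum>S\<in>Pow X. \<Sum>i\<in>S. F (S - {i}) i) = (\<Sum>(S, i)\<in>Sigma (Pow X) (\<lambda>S. S). F (S - {i}) i)"
    using assms by (intro sum.Sigma) (auto intro: finite_subset)
  also have "\<dots> = (\<Sum>(S, i)\<in>Sigma (Pow X) (\<lambda>S. X - S). F S i)"
    by (rule sum.reindex_bij_witness[where i = "\<lambda>(S, i). (insert i S, i)" and j = "\<lambda>(S, i). (S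
        - {i}, i)"])
      (auto simp: insert_absorb)
  also have "\<dots> = (\<Sum>S\<in>Pow X. \<Sum>i\<in>X - S. F S i)"
    using assms by (intro sum.Sigma[symmetric]) auto
  finally show ?thesis .
qed

lemma sum_Pow_insert:
  assumes "finite X" "w \<notin> X"
  shows "(\<Sum>S\<in>Pow (insert w X). f S) = (\<Sum>S\<in>Pow X. f S + f (insert w S))"
proof -
  have "inj_on (insert w) (Pow X)" using assms(2) by (intro inj_onI) (auto simp: insert_ident)
  moreover have "Pow X \<inter> insert w ` Pow X = {}" using assms(2) by auto
  ultimately show ?thesis
    using assms(1) by (simp add: Pow_insert sum.union_disjoint sum.reindex sum.distrib)
qed

lemma choose_two_Suc: "Suc m choose 2 = (m choose 2) + m"
  by (simp add: numeral_2_eq_2)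

lemma choose_two_add: "(m + k) choose 2 = (m choose 2) + (k choose 2) + m * k"
  by (induction k) (simp_all add: choose_two_Suc binomial_eq_0)

lemma power_two_choose_two: "m * m = (m choose 2) + (Suc m choose 2)"
  by (induction m) (simp_all add: choose_two_Suc binomial_eq_0)

text \<open>Applied below to each row of a set of pairs closed under passing from
  \<open>(i, s + 1)\<close> to \<open>(i, s)\<close>.\<close>

lemma finite_downset_eq_lessThan:
  fixes D :: "nat set"
  assumes "finite D" and "\<And>s. Suc s \<in> D \<Longrightarrow> s \<in> D"
  shows "D = {..<card D}"
proof -
  have down: "t \<in> D" if "s \<in> D" "t \<le> s" for s t
    using that(2,1) by (induction rule: inc_induct) (use assms(2) in auto)
  have "s < card D" if "s \<in> D" for s
  proof -
    have "{..s} \<subseteq> D" using down that by auto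
    then show ?thesis using card_mono[OF assms(1), of "{..s}"] by simp
  qed
  then have "D \<subseteq> {..<card D}" by auto
  then show ?thesis by (intro card_subset_eq) auto
qed

section \<open>Theta functions and the addition formula\<close>

locale nome =
  fixes p :: complex
  assumes norm_p: "norm p < 1"
begin

abbreviation T :: "complex \<Rightarrow> complex" where "T x \<equiv> theta x p"

text \<open>This is the infinite shifted factorial (y; p)_infinity. It is entire in
  \<open>y\<close>, so the holomorphy of \<open>T\<close> away from 0 follows from the splitting
  \<open>T_eq\<close>.\<close>

definition half_theta :: "complex \<Rightarrow> complex" where "half_theta y = (\<Prod>j. 1 - p ^ j * y)"

lemma convergent_half_theta: "convergent_prod (\<lambda>j. 1 - p ^ j * y)"
proof -
  have "summable (\<lambda>j. norm (p ^ j * y))"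
    using norm_p by (simp add: norm_mult norm_power summable_mult2 summable_geometric)
  then show ?thesis
    by (intro abs_convergent_prod_imp_convergent_prod) (simp add: abs_convergent_prod_conv_summable)
qed

lemma half_theta_0: "half_theta 0 = 1"
  by (simp add: half_theta_def)

lemma half_theta_eq_0_D: "half_theta y = 0 \<Longrightarrow> \<exists>j. p ^ j * y = 1"
  using has_prod_eq_0_iff[OF convergent_prod_has_prod[OF convergent_half_theta[of y]]]
  by (auto simp: half_theta_def)

lemma half_theta_step: "half_theta y = (1 - y) * half_theta (p * y)"
proof -
  have "half_theta y = (1 - y) * (\<Prod>j. 1 - p ^ Suc j * y)"
    unfolding half_theta_def
    using has_prod_unique[OF has_prod_ignore_initial_segment'[OF convergent_half_theta[of y], of 1]]
        by simp
  then show ?thesis by (simp add: half_theta_def mult_ac)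
qed

lemma half_theta_holomorphic: "half_theta holomorphic_on UNIV"
proof (rule holomorphic_uniform_sequence[where f = "\<lambda>n y. \<Prod>j<n. 1 - p ^ j * y"])
  show "\<exists>d>0. cball y d \<subseteq> UNIV \<and> uniform_limit (cball y d) (\<lambda>n y. \<Prod>j<n. 1 - p ^ j
      * y) half_theta sequentially" for y
  proof -
    have "uniformly_convergent_on (cball y 1) (\<lambda>n y. \<Prod>j<n. 1 - p ^ j * y)"
    proof (rule uniformly_convergent_on_prod')
      show "uniformly_convergent_on (cball y 1) (\<lambda>N z. \<Sum>j<N. norm (1 - p ^ j * z - 1))"
      proof (rule Weierstrass_m_test'[where M = "\<lambda>j. norm p ^ j * (norm y + 1)"])
        fix j z assume "z \<in> cball y 1"
        then have "norm z \<le> norm y + 1"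
          by (smt (verit) dist_norm mem_cball norm_minus_commute norm_triangle_ineq2)
        then show "norm (norm (1 - p ^ j * z - 1)) \<le> norm p ^ j * (norm y + 1)"
          by (simp add: norm_mult norm_power mult_left_mono)
      qed (use norm_p in \<open>simp add: summable_mult2 summable_geometric\<close>)
    qed (auto intro!: continuous_intros)
    then obtain l where l: "uniform_limit (cball y 1) (\<lambda>n y. \<Prod>j<n. 1 - p ^ j * y) l sequentially"
      by (auto simp: uniformly_convergent_on_def)
    have "l z = half_theta z" if "z \<in> cball y 1" for z
    proof -
      have "(\<lambda>n. \<Prod>j<n. 1 - p ^ j * z) \<longlonglongrightarrow> l z"
        using l that by (rule tendsto_uniform_limitI)
      moreover have "(\<lambda>n. \<Prod>j<n. 1 - p ^ j * z) \<longlonglongrightarrow> half_theta z"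
        using convergent_prod_LIMSEQ[OF convergent_half_theta[of z]]
        by - (rule LIMSEQ_imp_Suc, simp add: half_theta_def lessThan_Suc_atMost)
      ultimately show ?thesis by (rule LIMSEQ_unique)
    qed
    then have "uniform_limit (cball y 1) (\<lambda>n y. \<Prod>j<n. 1 - p ^ j * y) l sequentially \<longleftrightarrow>
        uniform_limit (cball y 1) (\<lambda>n y. \<Prod>j<n. 1 - p ^ j * y) half_theta sequentially"
      by (intro uniform_limit_cong') auto
    with l have "uniform_limit (cball y 1) (\<lambda>n y. \<Prod>j<n. 1 - p ^ j * y) half_theta sequentially"
      by simp
    then show ?thesis by (intro exI[of _ 1]) auto
  qed
qed (auto intro!: holomorphic_intros)

lemma T_eq: "T x = half_theta x * half_theta (p / x)"
proof -
  have "convergent_prod (\<lambda>j. 1 - p ^ j * (p / x))" by (rule convergent_half_theta)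
  then have "half_theta x * half_theta (p / x) = (\<Prod>j. (1 - p ^ j * x) * (1 - p ^ j * (p / x)))"
    unfolding half_theta_def by (intro prodinf_mult convergent_half_theta)
  then show ?thesis by (simp add: theta_def mult.commute)
qed

lemma T_1 [simp]: "T 1 = 0"
  using half_theta_step[of 1] by (simp add: T_eq)

lemma T_inverse: "x \<noteq> 0 \<Longrightarrow> T (1 / x) = - T x / x"
  by (simp add: T_eq half_theta_step[of x] half_theta_step[of "1 / x"] field_simps)

text \<open>The shift takes the factor \<open>1 - x\<close> from one half product and gives
  \<open>1 - 1 / x\<close> to the other. The equation fails at nome 0, so arguments by periodicity
  treat \<open>p = 0\<close> separately.\<close>

lemma T_shift: "x \<noteq> 0 \<Longrightarrow> p \<noteq> 0 \<Longrightarrow> T (p * x) = - T x / x"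
  by (simp add: T_eq half_theta_step[of x] half_theta_step[of "1 / x"] field_simps)

lemma T_eq_0_D:
  assumes "x \<noteq> 0" "T x = 0"
  shows "\<exists>m::int. x = p powi m"
proof -
  consider "half_theta x = 0" | "half_theta (p / x) = 0" using assms by (auto simp: T_eq)
  then show ?thesis
  proof cases
    case 1
    then obtain j where "p ^ j * x = 1" using half_theta_eq_0_D by blast
    then have "x = p powi (- int j)"
      by (simp add: power_int_minus inverse_unique mult.commute)
    then show ?thesis by blast
  next
    case 2
    then obtain j where "p ^ j * (p / x) = 1" using half_theta_eq_0_D by blast
    then have "x = p powi (int (Suc j))"
      using assms(1) by (simp only: power_int_of_nat) (simp add: field_simps)
    then show ?thesis by blast
  qed
qed

text \<open>The form \<open>c * s ^ e\<close> fits the curves in parameter space along which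
  genericity is removed.\<close>

lemma countable_T_zeros:
  assumes "c \<noteq> 0" "e > 0"
  shows "countable {s. T (c * s ^ e) = 0}"
proof -
  have sub: "{s. T (c * s ^ e) = 0} \<subseteq> insert 0 (\<Union>m::int. {s. s ^ e = p powi m / c})"
  proof
    fix s assume "s \<in> {s. T (c * s ^ e) = 0}"
    then have "s = 0 \<or> (\<exists>m::int. c * s ^ e = p powi m)"
      using T_eq_0_D[of "c * s ^ e"] assms by auto
    then show "s \<in> insert 0 (\<Union>m::int. {s. s ^ e = p powi m / c})"
      using assms(1) by (auto simp: eq_divide_eq mult.commute)
  qed
  have "countable {s::complex. s ^ e = w}" for w
    using finite_nth_roots[of e w] assms(2) by (simp add: countable_finite)
  then have "countable (insert 0 (\<Union>m::int. {s. s ^ e = p powi m / c}))"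
    by (intro countable_insert countable_UN) auto
  with sub show ?thesis by (rule countable_subset)
qed

lemma T_holomorphic [holomorphic_intros]:
  assumes "f holomorphic_on A" "\<And>z. z \<in> A \<Longrightarrow> f z \<noteq> 0"
  shows "(\<lambda>z. T (f z)) holomorphic_on A"
proof -
  have half_theta: "(\<lambda>z. half_theta (g z)) holomorphic_on A" if "g holomorphic_on A" for g
    using holomorphic_on_compose_gen[OF that half_theta_holomorphic] by (simp add: o_def)
  show ?thesis
    unfolding T_eq using assms by (intro holomorphic_intros half_theta) auto
qed

lemma T_isCont:
  assumes "isCont f z" "f z \<noteq> 0"
  shows "isCont (\<lambda>z. T (f z)) z"
proof -
  have "T holomorphic_on - {0}"
    by (intro holomorphic_intros) auto
  then have "isCont T (f z)"
    using assms(2) by (meson ComplI continuous_on_eq_continuous_at holomorphic_on_imp_continuous_on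
      open_Compl closed_singleton singletonD)
  with assms(1) show ?thesis
    by (rule isCont_o2)
qed

lemma T_nz_power: "q \<noteq> 0 \<Longrightarrow> (\<And>m::int. q \<noteq> p powi m) \<Longrightarrow> T q \<noteq> 0"
  using T_eq_0_D by blast


lemma T_has_deriv:
  assumes "z \<noteq> 0"
  shows "(T has_field_derivative deriv T z) (at z)"
proof -
  have "T holomorphic_on - {0}"
    by (intro holomorphic_intros) auto
  then show ?thesis
    using assms by (intro holomorphic_derivI[of _ "- {0}"]) auto
qed

text \<open>Differentiating \<open>T_shift\<close> gives one more term, which contains the factor
  \<open>T z\<close> and so vanishes.\<close>

lemma deriv_T_shift:
  assumes "p \<noteq> 0" "z \<noteq> 0" "T z = 0"
  shows "deriv T (p * z) * p = - deriv T z / z"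
proof (rule DERIV_unique)
  show "((\<lambda>x. T (p * x)) has_field_derivative deriv T (p * z) * p) (at z)"
    using assms by (intro DERIV_chain2[OF T_has_deriv]) (auto intro!: derivative_eq_intros)
  have "((\<lambda>x. - T x / x) has_field_derivative - deriv T z / z) (at z)"
    using assms T_has_deriv[of z]
    by (auto intro!: derivative_eq_intros simp: field_simps)
  then show "((\<lambda>x. T (p * x)) has_field_derivative - deriv T z / z) (at z)"
    by (rule has_field_derivative_transform_within_open[where S = "- {0}"])
      (use assms T_shift in auto)
qed

text \<open>The factor \<open>1 - x\<close> carries the zero; the cofactor \<open>g\<close> has at 1
  the value \<open>half_theta p\<close> squared, nonzero because no power \<open>p ^ (j + 1)\<close>
  equals 1.\<close>

lemma deriv_T_1: "deriv T 1 \<noteq> 0"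
proof -
  define g where "g x = half_theta (p * x) * half_theta (p / x)" for x
  have Tg: "T x = (1 - x) * g x" for x
    using half_theta_step[of x] by (simp add: T_eq g_def)
  have "half_theta p \<noteq> 0"
  proof
    assume "half_theta p = 0"
    then obtain j where "p ^ j * p = 1" using half_theta_eq_0_D by blast
    then have "norm p ^ Suc j = 1" by (metis norm_one norm_power power_Suc2)
    moreover have "norm p ^ Suc j < 1"
      using norm_p by (metis norm_ge_zero power_less_one_iff zero_less_Suc)
    ultimately show False by simp
  qed
  then have g1: "g 1 \<noteq> 0" by (simp add: g_def)
  have "g holomorphic_on - {0}"
    unfolding g_def
    by (intro holomorphic_intros holomorphic_on_compose_gen[OF _ half_theta_holomorphic, unfolded
        o_def]) auto
  then obtain g' where "(g has_field_derivative g') (at 1)"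
    by (metis ComplI holomorphic_derivI open_Compl closed_singleton singletonD zero_neq_one)
  then have "((\<lambda>x. (1 - x) * g x) has_field_derivative - g 1) (at 1)"
    by (auto intro!: derivative_eq_intros)
  then have "(T has_field_derivative - g 1) (at 1)"
    by (simp add: Tg[abs_def])
  then show ?thesis
    using g1 DERIV_imp_deriv by force
qed

text \<open>All zeros are integer powers of \<open>p\<close>, so simplicity at 1 spreads to them by
  \<open>deriv_T_shift\<close> in both directions.\<close>

lemma T_simple_zero:
  assumes "p \<noteq> 0" "z \<noteq> 0" "T z = 0"
  shows "deriv T z \<noteq> 0"
proof -
  have "T (p powi m) = 0 \<and> deriv T (p powi m) \<noteq> 0" for m :: int
  proof (induction m rule: int_induct[where k = 0])
    case base
    then show ?case by (simp add: deriv_T_1)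
  next
    case (step1 i)
    then show ?case
      using T_shift[of "p powi i"] deriv_T_shift[of "p powi i"] assms(1)
      by (auto simp: power_int_add mult.commute)
  next
    case (step2 i)
    have "p powi i = p * p powi (i - 1)"
      using assms(1) by (simp add: power_int_diff)
    then show ?case
      using step2 T_shift[of "p powi (i - 1)"] deriv_T_shift[of "p powi (i - 1)"] assms(1) by auto
  qed
  then show ?thesis
    using T_eq_0_D[OF assms(2,3)] by auto
qed

text \<open>In the variable \<open>u\<close> with \<open>z = exp u\<close> the function is entire,
  and by its period \<open>Ln p\<close> all its values occur on the compact annulus between the
  radii \<open>norm p\<close> and 1. Liouville's theorem applies.\<close>

lemma elliptic_const:
  assumes "p \<noteq> 0" and h: "h holomorphic_on - {0}"
    and per: "\<And>z. z \<noteq> 0 \<Longrightarrow> h (p * z) = h z" and "z \<noteq> 0" "w \<noteq> 0"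
  shows "h z = h w"
proof -
  define L where "L = Ln p"
  have eL: "exp L = p" using assms(1) by (simp add: L_def)
  have "exp (Re L) < 1" using norm_p eL by (metis norm_exp_eq_Re)
  then have ReL: "Re L < 0" by simp
  define f where "f u = h (exp u)" for u
  have f_per1: "f (u + of_nat n * L) = f u" for u n
  proof (induction n)
    case (Suc n)
    have "exp (u + of_nat (Suc n) * L) = p * exp (u + of_nat n * L)"
      by (simp add: exp_add eL[symmetric] algebra_simps)
    then show ?case using per[of "exp (u + of_nat n * L)"] Suc by (simp add: f_def)
  qed simp
  have f_per: "f (u + of_int m * L) = f u" for u m
  proof (cases "m \<ge> 0")
    case True
    then show ?thesis using f_per1[of u "nat m"] by (simp add: of_nat_nat)
  next
    case False
    then show ?thesis
      using f_per1[of "u + of_int m * L" "nat (- m)"] by simp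
  qed
  have "f holomorphic_on UNIV"
    unfolding f_def by (rule holomorphic_on_compose_gen[OF _ h, unfolded o_def]) (auto intro!:
        holomorphic_intros)
  moreover have "bounded (range f)"
  proof -
    define K where "K = {z::complex. norm p \<le> norm z \<and> norm z \<le> 1}"
    have "K = cball 0 1 - ball 0 (norm p)" by (auto simp: K_def)
    then have "compact K" by (simp add: compact_diff)
    moreover have "continuous_on K h"
      using holomorphic_on_imp_continuous_on[OF h] by (rule continuous_on_subset) (use assms(1) in
          \<open>auto simp: K_def\<close>)
    ultimately have "bounded (h ` K)" by (intro compact_imp_bounded compact_continuous_image)
    moreover have "range f \<subseteq> h ` K"
    proof
      fix y assume "y \<in> range f"
      then obtain u where u: "y = f u" by blast
      \<comment> \<open>The multiple of the period that moves \<open>Re u\<close> into the interval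
        from \<open>Re L\<close> to 0; here \<open>Re L\<close> is negative.\<close>
      define m where "m = - \<lfloor>Re u / Re L\<rfloor>"
      define u' where "u' = u + of_int m * L"
      have "real_of_int (- m) \<le> Re u / Re L" "Re u / Re L < real_of_int (- m) + 1"
        unfolding m_def by linarith+
      then have "Re u' \<le> 0" "Re L \<le> Re u'"
        using ReL by (simp_all add: u'_def field_simps)
      then have "exp u' \<in> K"
        using norm_exp_eq_Re[of u'] norm_exp_eq_Re[of L] by (simp add: K_def eL)
      moreover have "y = h (exp u')" using f_per[of u m] u by (simp add: f_def u'_def)
      ultimately show "y \<in> h ` K" by blast
    qed
    ultimately show ?thesis by (rule bounded_subset)
  qed
  ultimately have "f constant_on UNIV" using Liouville_theorem by blast
  then have "f (Ln z) = f (Ln w)" unfolding constant_on_def by auto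
  then show ?thesis using assms by (simp add: f_def)
qed

lemma T_shift_int:
  assumes "p \<noteq> 0" "x \<noteq> 0"
  shows "T (p powi m * x) = 0 \<longleftrightarrow> T x = 0"
proof (induction m rule: int_induct[where k = 0])
  case (step1 i)
  then show ?case
    using assms T_shift[of "p powi i * x"] by (simp add: power_int_add mult_ac)
next
  case (step2 i)
  have "p powi i * x = p * (p powi (i - 1) * x)"
    using assms(1) by (simp add: power_int_diff)
  then show ?case
    using step2 assms T_shift[of "p powi (i - 1) * x"] by (simp add: mult.assoc)
qed simp

lemma T_inverse_eq_0_iff: "x \<noteq> 0 \<Longrightarrow> T (1 / x) = 0 \<longleftrightarrow> T x = 0"
  by (simp add: T_inverse)

lemma T_flip: "x \<noteq> 0 \<Longrightarrow> y \<noteq> 0 \<Longrightarrow> T (x / y) = - (x / y) * T (y / x)"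
  using T_inverse[of "y / x"] by (simp add: field_simps)

text \<open>With Z = z/\<surd>P and C = c/\<surd>P this is the classical \<theta>(Z/C) \<theta>(ZC),
  the building block of Weierstrass' formula.\<close>

definition theta_pair :: "complex \<Rightarrow> complex \<Rightarrow> complex \<Rightarrow> complex" where
  "theta_pair P c z = T (z / c) * T (z * c / P)"

lemma theta_pair_self: "c \<noteq> 0 \<Longrightarrow> theta_pair P c c = 0"
  by (simp add: theta_pair_def)

lemma theta_pair_swap:
  assumes "c \<noteq> 0" "z \<noteq> 0"
  shows "theta_pair P z c = - (c / z) * theta_pair P c z"
  using T_flip[OF assms] by (simp add: theta_pair_def mult.commute)

text \<open>The multiplier does not depend on \<open>c\<close>, and neither does the one in
  \<open>theta_pair_reflect\<close>. Linear combinations of pairs with the same \<open>P\<close>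
  therefore transform alike.\<close>

lemma theta_pair_shift:
  assumes "p \<noteq> 0" "P \<noteq> 0" "c \<noteq> 0" "z \<noteq> 0"
  shows "theta_pair P c (p * z) = P / z ^ 2 * theta_pair P c z"
proof -
  have "theta_pair P c (p * z) = T (p * (z / c)) * T (p * (z * c / P))"
    by (simp add: theta_pair_def mult_ac)
  also have "\<dots> = P / z ^ 2 * theta_pair P c z"
    using assms by (subst (1 2) T_shift) (auto simp: theta_pair_def field_simps power2_eq_square)
  finally show ?thesis .
qed

lemma theta_pair_reflect:
  assumes "P \<noteq> 0" "c \<noteq> 0" "z \<noteq> 0"
  shows "theta_pair P c (P / z) = P / z ^ 2 * theta_pair P c z"
proof -
  have "theta_pair P c (P / z) = T (P / (z * c)) * T (c / z)"
    using assms by (simp add: theta_pair_def)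
  also have "\<dots> = P / z ^ 2 * theta_pair P c z"
    using assms T_flip[of P "z * c"] T_flip[of c z]
    by (simp add: theta_pair_def power2_eq_square)
  finally show ?thesis .
qed

lemma theta_pair_holomorphic [holomorphic_intros]:
  assumes "P \<noteq> 0" "c \<noteq> 0" "0 \<notin> S"
  shows "theta_pair P c holomorphic_on S"
  unfolding theta_pair_def[abs_def] using assms by (intro holomorphic_intros) auto

text \<open>The quotient of the two sides is elliptic without poles, hence constant
    by Liouville; it vanishes
  at \<open>b'\<close>.\<close>

lemma theta_pair_addition_generic:
  assumes "p \<noteq> 0" and nz: "P \<noteq> 0" "z \<noteq> 0" "c \<noteq> 0" "b \<noteq> 0" "b' \<noteq> 0"
    and gen: "theta_pair P b b' \<noteq> 0" "T (b ^ 2 / P) \<noteq> 0"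
  shows "theta_pair P c z * theta_pair P b b' = theta_pair P c b' * theta_pair P b z - b' / b
      * theta_pair P c b * theta_pair P b' z"
proof -
  \<comment> \<open>\<open>D\<close> is the difference of the two sides of the claim. It is a
    combination of pairs in \<open>z\<close> with the same \<open>P\<close> as \<open>E\<close>, so
    \<open>D / E\<close> is invariant under \<open>z \<mapsto> p * z\<close>.\<close>
  define D where "D z = theta_pair P c z * theta_pair P b b' + b' / b * theta_pair P c b
      * theta_pair P b' z - theta_pair P c b' * theta_pair P b z" for z
  define E where "E z = theta_pair P b z" for z
  define h where "h z = (if E z = 0 then deriv D z / deriv E z else D z / E z)" for z
  have D_shift: "D (p * z) = P / z ^ 2 * D z" if "z \<noteq> 0" for z
    using that assms by (simp add: D_def theta_pair_shift algebra_simps)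
  have D_reflect: "D (P / z) = P / z ^ 2 * D z" if "z \<noteq> 0" for z
    using that assms by (simp add: D_def theta_pair_reflect algebra_simps)
  have D_b: "D b = 0"
    using nz by (simp add: D_def theta_pair_self theta_pair_swap[of b b'])
  have D_b': "D b' = 0"
    using nz by (simp add: D_def theta_pair_self)
  have D_shift_int: "D (p powi m * z) = 0" if "z \<noteq> 0" "D z = 0" for z and m :: int
  proof (induction m rule: int_induct[where k = 0])
    case (step1 i)
    then show ?case
      using assms that D_shift[of "p powi i * z"] by (simp add: power_int_add mult_ac)
  next
    case (step2 i)
    have "p powi i * z = p * (p powi (i - 1) * z)"
      using assms(1) by (simp add: power_int_diff)
    then show ?case
      using step2 assms that D_shift[of "p powi (i - 1) * z"] by (simp add: mult.assoc)
  qed (use that in simp)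
  have hol: "D holomorphic_on - {0}" "E holomorphic_on - {0}"
    unfolding D_def E_def using nz by (auto intro!: holomorphic_intros)
  \<comment> \<open>The zeros of \<open>E\<close> form the orbits of \<open>b\<close> and
    \<open>P / b\<close> under powers of \<open>p\<close>. The condition on
    \<open>T (b ^ 2 / P)\<close> keeps these orbits apart, so the zeros are simple; \<open>D\<close>
    vanishes on the first by \<open>D_b\<close> and on the second by reflection.\<close>
  have E_zero: "D z = 0 \<and> deriv E z \<noteq> 0" if "z \<noteq> 0" "E z = 0" for z
  proof -
    have "((\<lambda>x. T (x / b)) has_field_derivative deriv T (z / b) * (1 / b)) (at z)"
      using nz that(1) by (intro DERIV_chain2[OF T_has_deriv]) (auto intro!: derivative_eq_intros)
    moreover have "((\<lambda>x. T (x * b / P)) has_field_derivative deriv T (z * b / P) * (b / P)) (at z)"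
      using nz that(1) by (intro DERIV_chain2[OF T_has_deriv]) (auto intro!: derivative_eq_intros)
    ultimately have *: "(E has_field_derivative (T (z / b) * (deriv T (z * b / P) * (b / P))
        + deriv T (z / b) * (1 / b) * T (z * b / P))) (at z)"
      unfolding E_def theta_pair_def by (rule DERIV_mult')
    have "T (z / b) = 0 \<or> T (z * b / P) = 0" using that(2) by (simp add: E_def theta_pair_def)
    then show ?thesis
    proof
      assume 0: "T (z / b) = 0"
      then obtain m :: int where m: "z / b = p powi m" using T_eq_0_D[OF _ 0] nz \<open>z \<noteq> 0\<close> by auto
      then have z: "z = p powi m * b" using nz by (simp add: field_simps)
      have "z * b / P = p powi m * (b ^ 2 / P)" by (simp add: z power2_eq_square)
      then have "T (z * b / P) \<noteq> 0" using gen(2) nz assms(1) T_shift_int[of "b ^ 2 / P" m] by simp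
      moreover have "deriv T (z / b) \<noteq> 0" using 0 nz that assms(1) by (intro T_simple_zero) auto
      ultimately have "deriv E z \<noteq> 0" using DERIV_imp_deriv[OF *] 0 nz by simp
      with D_shift_int[of b m] D_b nz show ?thesis by (simp add: z)
    next
      assume 0: "T (z * b / P) = 0"
      then obtain m :: int where m: "z * b / P = p powi m" using T_eq_0_D[OF _ 0] nz \<open>z \<noteq> 0\<close> by auto
      then have z: "z = p powi m * (P / b)" using nz by (simp add: field_simps)
      have "z / b = p powi m * (1 / (b ^ 2 / P))" by (simp add: z power2_eq_square)
      then have "T (z / b) \<noteq> 0"
        using gen(2) nz assms(1) T_shift_int[of "1 / (b ^ 2 / P)" m] T_inverse_eq_0_iff[of "b ^ 2 /
            P"] by simp
      moreover have "deriv T (z * b / P) \<noteq> 0" using 0 nz that assms(1) by (intro T_simple_zero) auto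
      ultimately have "deriv E z \<noteq> 0" using DERIV_imp_deriv[OF *] 0 nz by simp
      with D_shift_int[of "P / b" m] D_b D_reflect[of b] nz show ?thesis by (simp add: z)
    qed
  qed
  have h_hol: "h holomorphic_on - {0}"
    unfolding h_def using hol E_zero by (intro holomorphic_quotient) auto
  have h_per: "h (p * z) = h z" if "z \<noteq> 0" for z
  proof -
    have "isCont h u" if "u \<noteq> 0" for u
      using that holomorphic_on_imp_continuous_on[OF h_hol]
      by (simp add: continuous_on_eq_continuous_at open_Compl)
    \<comment> \<open>Periodicity is clear where \<open>E\<close> does not vanish; the countably
      many other points follow by continuity.\<close>
    then have "isCont (\<lambda>z. h (p * z) - h z) z"
      using that assms(1) by (intro continuous_intros isCont_o2[of _ "(*) p" h]) auto
    moreover have "countable ({0} \<union> {z. T ((1 / b) * z ^ 1) = 0} \<union> {z. T ((b / P) * z ^ 1) = 0})"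
      using nz by (intro countable_Un countable_T_zeros) auto
    moreover have "h (p * z) - h z = 0"
      if "z \<notin> {0} \<union> {z. T ((1 / b) * z ^ 1) = 0} \<union> {z. T ((b / P) * z ^ 1) = 0}" for z
    proof -
      have "z \<noteq> 0" "E z \<noteq> 0" using that by (auto simp: E_def theta_pair_def mult.commute)
      moreover have "E (p * z) = P / z ^ 2 * E z"
        using \<open>z \<noteq> 0\<close> nz assms(1) by (simp add: E_def theta_pair_shift)
      ultimately show ?thesis using D_shift[of z] nz by (simp add: h_def)
    qed
    ultimately have "(\<lambda>z. h (p * z) - h z) z = 0" by (rule eq_zero_if_zero_off_countable)
    then show ?thesis by simp
  qed
  have "h z = h b'"
    using elliptic_const[OF assms(1) h_hol h_per] nz by blast
  moreover have "h b' = 0" using gen(1) D_b' by (simp add: h_def E_def)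
  ultimately have "D z = 0" using E_zero[of z] nz by (auto simp: h_def split: if_splits)
  then show ?thesis by (simp add: D_def algebra_simps)
qed

lemma theta_nome_0:
  assumes "p = 0"
  shows "T x = 1 - x"
proof -
  have "p * x = 0" "p / x = 0" using assms by simp_all
  then show ?thesis
    by (simp only: T_eq half_theta_step[of x] half_theta_0) simp
qed

text \<open>The addition formula of Weierstrass, in a form free of square roots: for fixed \<open>P\<close>, the
  functions \<^term>\<open>theta_pair P c\<close> span a space of dimension two.\<close>

lemma theta_pair_addition:
  assumes nz: "P \<noteq> 0" "z \<noteq> 0" "c \<noteq> 0" "b \<noteq> 0" "b' \<noteq> 0"
  shows "theta_pair P c z * theta_pair P b b' = theta_pair P c b' * theta_pair P b z - b' / b
      * theta_pair P c b * theta_pair P b' z"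
proof (cases "p = 0")
  case True
  show ?thesis using nz
    by (simp only: theta_pair_def theta_nome_0[OF True]) (simp add: field_simps power2_eq_square)
next
  case False
  define F where "F b = theta_pair P c z * theta_pair P b b' - theta_pair P c b' * theta_pair P b z
      + b' / b * theta_pair P c b * theta_pair P b' z" for b
  \<comment> \<open>The values of \<open>b\<close> at which the generic lemma does not apply.
    \<open>T (b' / b)\<close> is replaced by its flip \<open>T (b / b')\<close> to put the variable
    in the numerator.\<close>
  define B where "B = {0} \<union> {b. T ((1 / b') * b ^ 1) = 0} \<union> {b. T ((b' / P) * b ^ 1) =
      0} \<union> {b. T ((1 / P) * b ^ 2) = 0}"
  have "isCont F b"
    unfolding F_def theta_pair_def using nz by (intro continuous_intros T_isCont) auto
  moreover have "countable B"
    unfolding B_def using nz by (intro countable_Un countable_T_zeros) auto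
  moreover have "F b = 0" if "b \<notin> B" for b
  proof -
    have "b \<noteq> 0" using that by (simp add: B_def)
    moreover have "theta_pair P b b' \<noteq> 0" "T (b ^ 2 / P) \<noteq> 0"
      using that T_flip[of b' b] nz by (auto simp: B_def theta_pair_def mult.commute)
    ultimately show ?thesis using theta_pair_addition_generic[OF False nz(1-3) _ nz(5), of b]
        by (simp add: F_def)
  qed
  ultimately have "F b = 0" by (rule eq_zero_if_zero_off_countable)
  then show ?thesis by (simp add: F_def algebra_simps)
qed


section \<open>Elliptic partial fractions\<close>

text \<open>Kronecker's theta quotient: for generic \<open>s\<close> it has, in \<open>z\<close>,
  poles only at \<open>b\<close> and its translates by powers of \<open>p\<close>, and multiplier
  \<open>1 / s\<close> under \<open>z \<mapsto> p * z\<close>. Dividing by \<open>T s\<close> makes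
  the residue at \<open>b\<close> independent of \<open>s\<close>.\<close>

definition pf_kernel :: "complex \<Rightarrow> complex \<Rightarrow> complex \<Rightarrow> complex" where
  "pf_kernel s b z = T (s * z / b) / (T (z / b) * T s)"

text \<open>One more factor adds a pole at \<open>y\<close> and changes the kernel parameter from
  \<open>s\<close> to \<open>s * g\<close>. With two poles the identity is the addition formula
  itself.\<close>

lemma pf_kernel_mult:
  assumes nz: "z \<noteq> 0" "b \<noteq> 0" "y \<noteq> 0" "s \<noteq> 0" "g \<noteq> 0"
    and T_nz: "T (z / b) \<noteq> 0" "T (z / y) \<noteq> 0" "T (y / b) \<noteq> 0" "T s \<noteq> 0" "T (s * g) \<noteq> 0"
  shows "pf_kernel s b z * (T (g * z / y) / T (z / y)) =
    T (g * b / y) / T (b / y) * pf_kernel (s * g) b z + pf_kernel s b y * T g * pf_kernel (s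
        * g) y z"
proof -
  \<comment> \<open>This \<open>P\<close> makes \<open>theta_pair P (b / s) z\<close> equal to
    \<open>T (s * z / b) * T (g * z / y)\<close>, the numerator on the left.\<close>
  define P where "P = b * y / (s * g)"
  have "theta_pair P (b / s) z * theta_pair P b y = theta_pair P (b / s) y * theta_pair P b z
      - y / b * theta_pair P (b / s) b * theta_pair P y z"
    using nz by (intro theta_pair_addition) (auto simp: P_def)
  then have eq: "T (s * z / b) * T (g * z / y) * (T (y / b) * T (s * g)) =
      T (s * y / b) * T g * (T (z / b) * T (s * g * z / y))
      - y / b * (T s * T (g * b / y)) * (T (z / y) * T (s * g * z / b))"
    using nz by (simp add: theta_pair_def P_def mult_ac)
  have flip: "T (b / y) = - (b / y) * T (y / b)" using nz by (intro T_flip)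
  show ?thesis
    unfolding pf_kernel_def flip using eq T_nz nz by (simp add: field_simps)
qed

text \<open>The parameter \<open>s\<close> of \<^term>\<open>pf_kernel\<close> is forced by the multiplier of the left-hand side under
  \<open>z \<mapsto> pz\<close>.\<close>

lemma theta_partial_fractions:
  fixes y :: "'i \<Rightarrow> complex"
  assumes "finite I" and nz: "g \<noteq> 0" "a \<noteq> 0" "b \<noteq> 0" "\<And>i. i \<in> I \<Longrightarrow> y i \<noteq> 0"
    and y_b: "\<And>i. i \<in> I \<Longrightarrow> T (y i / b) \<noteq> 0"
    and y_y: "\<And>i j. i \<in> I \<Longrightarrow> j \<in> I \<Longrightarrow> i \<noteq> j \<Longrightarrow> T (y i / y j) \<noteq> 0"
    and s: "\<And>k. k \<le> card I \<Longrightarrow> T (b / a * g ^ k) \<noteq> 0"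
    and z: "z \<noteq> 0" "T (z / b) \<noteq> 0" "\<And>i. i \<in> I \<Longrightarrow> T (z / y i) \<noteq> 0"
  shows "T (z / a) / T (z / b) * (\<Prod>i\<in>I. T (g * z / y i) / T (z / y i)) =
    T (b / a) * (\<Prod>i\<in>I. T (g * b / y i) / T (b / y i)) * pf_kernel (b / a * g ^ card I) b z
    + (\<Sum>i\<in>I. T (y i / a) / T (y i / b) * T g * (\<Prod>j\<in>I - {i}. T (g * y i / y j) / T (y i / y j))
        * pf_kernel (b / a * g ^ card I) (y i) z)"
  using assms
proof (induction I arbitrary: z rule: finite_induct)
  case empty
  then have "T (b / a) \<noteq> 0" using empty(7)[of 0] by simp
  then show ?case using empty by (simp add: pf_kernel_def)
next
  case (insert w I)
  define s where "s = b / a * g ^ card I"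
  define C where "C = T (b / a) * (\<Prod>i\<in>I. T (g * b / y i) / T (b / y i))"
  define D where "D i = T (y i / a) / T (y i / b) * T g * (\<Prod>j\<in>I - {i}. T (g
      * y i / y j) / T (y i / y j))" for i
  have s': "b / a * g ^ card (insert w I) = s * g" using insert(1,2) by (simp add: s_def)
  have s_nz: "s \<noteq> 0" "T s \<noteq> 0" "T (s * g) \<noteq> 0"
    using insert.prems(7)[of "card I"] insert.prems(7)[of "Suc (card I)"] insert(1,2)
        insert.prems(1-3)
    by (auto simp: s_def mult_ac)
  have IH: "T (z / a) / T (z / b) * (\<Prod>i\<in>I. T (g * z / y i) / T (z / y i)) =
      C * pf_kernel s b z + (\<Sum>i\<in>I. D i * pf_kernel s (y i) z)"
    if "z \<noteq> 0" "T (z / b) \<noteq> 0" "\<And>i. i \<in> I \<Longrightarrow> T (z / y i) \<noteq> 0" for z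
    unfolding C_def D_def s_def
    by (rule insert.IH) (use insert that in auto)
  define R where "R u = T (g * u / y w) / T (u / y w)" for u
  have ww: "y w \<noteq> 0" "T (y w / b) \<noteq> 0" "T (z / y w) \<noteq> 0" using insert.prems by auto
  have two: "pf_kernel s u z * R z = R u * pf_kernel (s * g) u z + pf_kernel s u (y w) * T g
      * pf_kernel (s * g) (y w) z"
    if "u \<noteq> 0" "T (z / u) \<noteq> 0" "T (y w / u) \<noteq> 0" for u
    unfolding R_def using that insert.prems s_nz ww by (intro pf_kernel_mult) auto
  have "T (z / a) / T (z / b) * (\<Prod>i\<in>insert w I. T (g * z / y i) / T (z / y i)) =
      (T (z / a) / T (z / b) * (\<Prod>i\<in>I. T (g * z / y i) / T (z / y i))) * R z"
    using insert(1,2) by (simp add: R_def)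
  also have "\<dots> = C * (pf_kernel s b z * R z) + (\<Sum>i\<in>I. D i * (pf_kernel s (y i) z * R z))"
    using insert.prems by (subst IH) (auto simp: algebra_simps sum_distrib_left)
  also have "\<dots> = C * (R b * pf_kernel (s * g) b z + pf_kernel s b (y w) * T g * pf_kernel (s
      * g) (y w) z) +
      (\<Sum>i\<in>I. D i * (R (y i) * pf_kernel (s * g) (y i) z + pf_kernel s (y i) (y w) * T g
          * pf_kernel (s * g) (y w) z))"
    using insert.prems insert(2) by (intro arg_cong2[of _ _ _ _ "(+)"] arg_cong2[of _ _ _ _ "(*)"]
        sum.cong two refl) auto
  also have "\<dots> = C * R b * pf_kernel (s * g) b z + (\<Sum>i\<in>I. D i * R (y i) * pf_kernel (s * g) (y i) z)
      + (C * pf_kernel s b (y w) + (\<Sum>i\<in>I. D i * pf_kernel s (y i) (y w))) * (T g * pf_kernel (s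
          * g) (y w) z)"
    by (simp add: algebra_simps sum.distrib sum_distrib_left)
  \<comment> \<open>The coefficient of the new pole is the old partial fraction expansion evaluated
    at \<open>z = y w\<close>.\<close>
  also have "C * pf_kernel s b (y w) + (\<Sum>i\<in>I. D i * pf_kernel s (y i) (y w)) =
      T (y w / a) / T (y w / b) * (\<Prod>i\<in>I. T (g * y w / y i) / T (y w / y i))"
    using insert.prems insert(2) by (subst IH) auto
  also have "(\<Sum>i\<in>I. D i * R (y i) * pf_kernel (s * g) (y i) z) =
     (\<Sum>i\<in>I. T (y i / a) / T (y i / b) * T g * (\<Prod>j\<in>insert w I - {i}. T (g
         * y i / y j) / T (y i / y j))
        * pf_kernel (s * g) (y i) z)"
  proof (rule sum.cong[OF refl])
    fix i assume i: "i \<in> I"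
    then have "insert w I - {i} = insert w (I - {i})" using insert(2) by auto
    then show "D i * R (y i) * pf_kernel (s * g) (y i) z = T (y i / a) / T (y i / b) * T g *
        (\<Prod>j\<in>insert w I - {i}. T (g * y i / y j) / T (y i / y j)) * pf_kernel (s * g) (y i) z"
      using insert(1,2) by (simp add: D_def R_def)
  qed
  finally show ?case
    unfolding s' using insert(1,2) by (simp add: C_def R_def algebra_simps)
qed

end

section \<open>Elliptic shifted factorials and the two partial fractions used for insertion\<close>

locale elliptic = nome +
  fixes q :: complex
  assumes q_nz: "q \<noteq> 0"
begin

abbreviation pp :: "complex \<Rightarrow> nat \<Rightarrow> complex" where "pp u k \<equiv> ell_fact u q p k"

lemma pp_0 [simp]: "pp u 0 = 1"
  by (simp add: ell_fact_def)

lemma pp_Suc: "pp u (Suc k) = pp u k * T (u * q ^ k)"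
  by (simp add: ell_fact_def)

lemma pp_add: "pp u (m + k) = pp u m * pp (u * q ^ m) k"
  by (induction k) (simp_all add: pp_Suc power_add mult_ac)

lemma pp_Suc': "pp u (Suc k) = T u * pp (u * q) k"
  using pp_add[of u 1 k] by (simp add: pp_Suc)

text \<open>The interaction of a point \<open>x\<close> inside the subset with a point
  \<open>y\<close> outside. It vanishes at \<open>x = q * y\<close>, and its product along
  \<open>y, q * y, q ^ 2 * y, ...\<close> telescopes.\<close>

definition theta_ratio :: "complex \<Rightarrow> complex \<Rightarrow> complex" where
  "theta_ratio x y = T (x / (q * y)) / T (x / y)"

lemma theta_ratio_eq:
  assumes "x \<noteq> 0" "y \<noteq> 0"
  shows "theta_ratio x y = T (q * y / x) / T (y / x) / q"
  using assms q_nz T_flip[of x "q * y"] T_flip[of x y] by (simp add: theta_ratio_def)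

text \<open>This is \<open>theta_partial_fractions\<close> with \<open>g = q\<close>, zero at
  \<open>1 / A\<close> and extra pole at \<open>1 / k\<close>. The value of \<open>k\<close> is the
  one that turns the kernel parameter \<open>A / k * q ^ card S\<close> into
  \<open>a * q ^ (2 * card S)\<close>.\<close>

lemma partial_fractions_low:
  fixes x :: "'i \<Rightarrow> complex"
  assumes "finite S" and nz: "A \<noteq> 0" "a \<noteq> 0" "z \<noteq> 0" "\<And>i. i \<in> S \<Longrightarrow> x i \<noteq> 0"
    and k: "k = A / (a * q ^ card S)"
    and gen: "\<And>i. T (a * q ^ i) \<noteq> 0" "\<And>i. i \<in> S \<Longrightarrow> T (k * x i) \<noteq> 0" "T (k * z) \<noteq> 0"
    and x_x: "\<And>i j. i \<in> S \<Longrightarrow> j \<in> S \<Longrightarrow> i \<noteq> j \<Longrightarrow> T (x i / x j) \<noteq> 0"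
    and x_z: "\<And>i. i \<in> S \<Longrightarrow> T (z / x i) \<noteq> 0"
  shows "T (A * z) * (\<Prod>i\<in>S. theta_ratio (x i) z) =
    T (a * q ^ card S) / T (a * q ^ (2 * card S)) * T (A * q ^ card S * z) *
      (\<Prod>i\<in>S. T (k * x i / q) / T (k * x i))
    - (\<Sum>i\<in>S. T (1 / q) * T (k * z) * pf_kernel (a * q ^ (2 * card S)) (x i) z * T (A * x i) / T (k
        * x i)
        * (\<Prod>j\<in>S - {i}. theta_ratio (x j) (x i)))"
proof -
  define N where "N = card S"
  have k_nz: "k \<noteq> 0" using k nz q_nz by simp
  have s: "(1 / k) / (1 / A) * q ^ j = a * q ^ (N + j)" for j
    using nz q_nz by (simp add: k N_def power_add)
  have gs: "T ((1 / k) / (1 / A) * q ^ j) \<noteq> 0" for j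
    unfolding s by (rule gen)
  have s2: "(1 / k) / (1 / A) * q ^ card S = a * q ^ (2 * N)"
    using s[of N] by (simp add: N_def mult_2)
  have s0: "(1 / k) / (1 / A) = a * q ^ N" using s[of 0] by simp
  have rr1: "(\<Prod>i\<in>S. theta_ratio (x i) z) = (\<Prod>i\<in>S. T (q * z / x i) / T (z / x i)) / q ^ N"
    using nz by (simp add: theta_ratio_eq prod_dividef prod.distrib N_def)
  have rr2: "(\<Prod>j\<in>S - {i}. T (q * x i / x j) / T (x i / x j)) * T q / q ^ N =
      - T (1 / q) * (\<Prod>j\<in>S - {i}. theta_ratio (x j) (x i))" if "i \<in> S" for i
  proof -
    have "(\<Prod>j\<in>S - {i}. theta_ratio (x j) (x i)) = (\<Prod>j\<in>S - {i}. T (q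
        * x i / x j) / T (x i / x j)) / q ^ (N - 1)"
      using nz that assms(1) by (simp add: theta_ratio_eq prod_dividef prod.distrib N_def)
    moreover have "q ^ N = q * q ^ (N - 1)"
      using that assms(1) by (metis N_def card_gt_0_iff empty_iff power_minus_mult mult.commute)
    ultimately show ?thesis using q_nz T_inverse[of q] by simp
  qed
  have rr3: "(\<Prod>i\<in>S. T (q * (1 / k) / x i) / T ((1 / k) / x i)) / q ^ N = (\<Prod>i\<in>S. T (k
      * x i / q) / T (k * x i))"
  proof -
    have "(\<Prod>i\<in>S. T (k * x i / q) / T (k * x i)) = (\<Prod>i\<in>S. theta_ratio (x i) (1 / k))"
      by (simp add: theta_ratio_def mult.commute)
    also have "\<dots> = (\<Prod>i\<in>S. T (q * (1 / k) / x i) / T ((1 / k) / x i)) / q ^ N"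
      using nz k_nz by (simp add: theta_ratio_eq prod_dividef prod.distrib N_def)
    finally show ?thesis by simp
  qed
  have "T (z / (1 / A)) / T (z / (1 / k)) * (\<Prod>i\<in>S. T (q * z / x i) / T (z / x i)) =
    T ((1 / k) / (1 / A)) * (\<Prod>i\<in>S. T (q * (1 / k) / x i) / T ((1 / k) / x i))
        * pf_kernel ((1 / k) / (1 / A) * q ^ card S) (1 / k) z
    + (\<Sum>i\<in>S. T (x i / (1 / A)) / T (x i / (1 / k)) * T q * (\<Prod>j\<in>S - {i}. T (q
        * x i / x j) / T (x i / x j))
        * pf_kernel ((1 / k) / (1 / A) * q ^ card S) (x i) z)"
    using assms k_nz q_nz by (intro theta_partial_fractions gs) (auto simp: mult.commute)
  then have "T (A * z) / T (k * z) * (\<Prod>i\<in>S. T (q * z / x i) / T (z / x i)) =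
    T (a * q ^ N) * (\<Prod>i\<in>S. T (q * (1 / k) / x i) / T ((1 / k) / x i)) * pf_kernel (a * q ^ (2
        * N)) (1 / k) z
    + (\<Sum>i\<in>S. T (A * x i) / T (k * x i) * T q * (\<Prod>j\<in>S - {i}. T (q * x i / x j) / T (x i / x j))
        * pf_kernel (a * q ^ (2 * N)) (x i) z)"
    unfolding s2 unfolding s0 by (simp add: mult.commute)
  then have "T (A * z) * (\<Prod>i\<in>S. theta_ratio (x i) z) = T (k * z) / q ^ N * (
    T (a * q ^ N) * (\<Prod>i\<in>S. T (q * (1 / k) / x i) / T ((1 / k) / x i)) * pf_kernel (a * q ^ (2
        * N)) (1 / k) z
    + (\<Sum>i\<in>S. T (A * x i) / T (k * x i) * T q * (\<Prod>j\<in>S - {i}. T (q * x i / x j) / T (x i / x j))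
        * pf_kernel (a * q ^ (2 * N)) (x i) z))"
    unfolding rr1 using gen(3) by (simp add: field_simps)
  also have "\<dots> = T (a * q ^ N) * ((\<Prod>i\<in>S. T (q * (1 / k) / x i) / T ((1 / k) / x i)) / q ^ N) * (T (k
      * z) * pf_kernel (a * q ^ (2 * N)) (1 / k) z)
    + (\<Sum>i\<in>S. T (A * x i) / T (k * x i) * ((\<Prod>j\<in>S - {i}. T (q * x i / x j) / T (x i / x j))
        * T q / q ^ N)
        * T (k * z) * pf_kernel (a * q ^ (2 * N)) (x i) z)"
    by (simp add: algebra_simps sum_distrib_left sum_divide_distrib)
  also have "(\<Sum>i\<in>S. T (A * x i) / T (k * x i) * ((\<Prod>j\<in>S - {i}. T (q * x i / x j) / T (x i / x j))
      * T q / q ^ N)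
        * T (k * z) * pf_kernel (a * q ^ (2 * N)) (x i) z) =
      - (\<Sum>i\<in>S. T (1 / q) * T (k * z) * pf_kernel (a * q ^ (2 * N)) (x i) z * T (A * x i) / T (k
          * x i)
        * (\<Prod>j\<in>S - {i}. theta_ratio (x j) (x i)))"
    unfolding sum_negf[symmetric] by (intro sum.cong refl) (simp only: rr2, simp add: mult_ac)
  \<comment> \<open>Multiplication by \<open>T (k * z)\<close> removes the auxiliary pole and leaves
    the theta factor needed in \<open>basis_step\<close>.\<close>
  also have "T (k * z) * pf_kernel (a * q ^ (2 * N)) (1 / k) z = T (A * q ^ N * z) / T (a * q ^ (2
      * N))"
  proof -
    have eq: "a * q ^ (2 * N) * z / (1 / k) = A * q ^ N * z" "z / (1 / k) = k * z"
      using nz q_nz by (simp_all add: k N_def mult_2 power_add)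
    show ?thesis unfolding pf_kernel_def eq using gen(3) by simp
  qed
  finally show ?thesis unfolding rr3 by (simp add: N_def)
qed

text \<open>Now \<open>z\<close> stands in the first argument of \<open>theta_ratio\<close>, so
  \<open>g = 1 / q\<close> and each point of \<open>R\<close> divides the kernel parameter by
  \<open>q\<close>.\<close>

lemma partial_fractions_high:
  fixes x :: "'i \<Rightarrow> complex"
  assumes "finite R" and nz: "A \<noteq> 0" "k \<noteq> 0" "z \<noteq> 0" "\<And>i. i \<in> R \<Longrightarrow> x i \<noteq> 0"
    and gen: "\<And>i. i \<le> card R \<Longrightarrow> T (A / (k * q ^ i)) \<noteq> 0" "\<And>i. i \<in> R \<Longrightarrow> T (k * x i) \<noteq> 0" "T (k
        * z) \<noteq> 0"
    and x_x: "\<And>i j. i \<in> R \<Longrightarrow> j \<in> R \<Longrightarrow> i \<noteq> j \<Longrightarrow> T (x i / x j) \<noteq> 0"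
    and x_z: "\<And>i. i \<in> R \<Longrightarrow> T (z / x i) \<noteq> 0"
    and s: "s = A / (k * q ^ card R)"
  shows "T (A * z) * (\<Prod>i\<in>R. theta_ratio z (x i)) =
    T (A / k) / T s * T (s * k * z) * (\<Prod>i\<in>R. T (k * q * x i) / T (k * x i)) / q ^ card R
    + (\<Sum>i\<in>R. T (1 / q) * T (k * z) * pf_kernel s (x i) z * T (A * x i) / T (k * x i)
        * (\<Prod>j\<in>R - {i}. theta_ratio (x i) (x j)))"
proof -
  have s': "(1 / k) / (1 / A) * (1 / q) ^ j = A / (k * q ^ j)" for j
    by (simp add: power_divide)
  have gs: "T ((1 / k) / (1 / A) * (1 / q) ^ j) \<noteq> 0" if "j \<le> card R" for j
    unfolding s' using that by (rule gen)
  have rr3: "(\<Prod>i\<in>R. T (1 / q * (1 / k) / x i) / T ((1 / k) / x i)) = (\<Prod>i\<in>R. T (k * q * x i) / T (k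
      * x i)) / q ^ card R"
  proof -
    have "T (1 / q * (1 / k) / x i) / T ((1 / k) / x i) = T (k * q * x i) / T (k * x i) / q" if "i
        \<in> R" for i
      using nz that q_nz T_inverse[of "k * q * x i"] T_inverse[of "k * x i"] by (simp add: mult_ac)
    then show ?thesis by (simp add: prod_dividef prod.distrib)
  qed
  have "T (z / (1 / A)) / T (z / (1 / k)) * (\<Prod>i\<in>R. T (1 / q * z / x i) / T (z / x i)) =
    T ((1 / k) / (1 / A)) * (\<Prod>i\<in>R. T (1 / q * (1 / k) / x i) / T ((1 / k) / x i))
        * pf_kernel ((1 / k) / (1 / A) * (1 / q) ^ card R) (1 / k) z
    + (\<Sum>i\<in>R. T (x i / (1 / A)) / T (x i / (1 / k)) * T (1 / q) * (\<Prod>j\<in>R - {i}. T (1 / q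
        * x i / x j) / T (x i / x j))
        * pf_kernel ((1 / k) / (1 / A) * (1 / q) ^ card R) (x i) z)"
    using assms q_nz by (intro theta_partial_fractions gs) (auto simp: mult.commute)
  then have "T (A * z) / T (k * z) * (\<Prod>i\<in>R. theta_ratio z (x i)) =
    T (A / k) * ((\<Prod>i\<in>R. T (k * q * x i) / T (k * x i)) / q ^ card R) * pf_kernel s (1 / k) z
    + (\<Sum>i\<in>R. T (A * x i) / T (k * x i) * T (1 / q) * (\<Prod>j\<in>R - {i}. theta_ratio (x i) (x j))
        * pf_kernel s (x i) z)"
    unfolding s' rr3 theta_ratio_def s[symmetric] by (simp add: mult.commute)
  then have "T (A * z) * (\<Prod>i\<in>R. theta_ratio z (x i)) = T (k * z) * (
    T (A / k) * ((\<Prod>i\<in>R. T (k * q * x i) / T (k * x i)) / q ^ card R) * pf_kernel s (1 / k) z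
    + (\<Sum>i\<in>R. T (A * x i) / T (k * x i) * T (1 / q) * (\<Prod>j\<in>R - {i}. theta_ratio (x i) (x j))
        * pf_kernel s (x i) z))"
    using gen(3) by (simp add: field_simps)
  also have "\<dots> = T (A / k) * ((\<Prod>i\<in>R. T (k * q * x i) / T (k * x i)) / q ^ card R) * (T (k * z)
      * pf_kernel s (1 / k) z)
    + (\<Sum>i\<in>R. T (1 / q) * T (k * z) * pf_kernel s (x i) z * T (A * x i) / T (k * x i)
        * (\<Prod>j\<in>R - {i}. theta_ratio (x i) (x j)))"
    by (simp add: algebra_simps sum_distrib_left)
  also have "T (k * z) * pf_kernel s (1 / k) z = T (s * k * z) / T s"
    using gen(3) by (simp add: pf_kernel_def mult_ac)
  finally show ?thesis by (simp add: mult_ac)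
qed


section \<open>Expansion of a product over a finite set of points\<close>

text \<open>The last line is the basis function of the overview; all that precedes it depends on
  \<open>b\<close> and \<open>c\<close> only through \<open>b * c\<close>.\<close>

definition coeff :: "complex \<Rightarrow> complex \<Rightarrow> complex \<Rightarrow> nat \<Rightarrow> nat \<Rightarrow> complex" where
  "coeff b c a M N = T (a * q ^ (2 * N)) / (pp (a * q ^ N) (Suc M) * pp (a * q / (b * c)) M)
     * ((- a / (b * c)) ^ N * q ^ (N * M) / q ^ (N choose 2))
     * (pp b N * pp c N * pp (a * q ^ Suc N / b) (M - N) * pp (a * q ^ Suc N / c) (M - N))"

definition outer_factor :: "complex \<Rightarrow> complex \<Rightarrow> nat \<Rightarrow> complex \<Rightarrow> complex" where
  "outer_factor A B N u = T (A * u) * T (B / q ^ N * u)"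

text \<open>Its second theta factor contains \<open>a\<close> and \<open>M\<close> only as
  \<open>a * q ^ M\<close>, so it does not change when a point is removed and \<open>a\<close>
  becomes \<open>a * q\<close>.\<close>

definition inner_factor :: "complex \<Rightarrow> complex \<Rightarrow> complex \<Rightarrow> nat \<Rightarrow> nat \<Rightarrow> complex \<Rightarrow> complex" where
  "inner_factor A B a M N u = T (A / (a * q ^ N) * u) * T (a * q ^ M * B * u)"

definition subset_term :: "('i \<Rightarrow> complex) \<Rightarrow> complex \<Rightarrow> complex \<Rightarrow> complex \<Rightarrow> 'i set \<Rightarrow> 'i set \<Rightarrow> complex"
    where
  "subset_term x A B a X S = (\<Prod>i\<in>S. \<Prod>j\<in>X - S. theta_ratio (x i) (x j))
     * (\<Prod>j\<in>X - S. outer_factor A B (card S) (x j))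
         * (\<Prod>i\<in>S. inner_factor A B a (card X) (card S) (x i))"

text \<open>The partial fraction with pole at \<open>x i\<close> which, up to sign, the terms of \<open>insert i S\<close> and of
  \<open>insert w S\<close> share as functions of the new point \<open>z\<close> with index \<open>w\<close>.\<close>

definition subset_residue :: "('i \<Rightarrow> complex) \<Rightarrow> complex \<Rightarrow> complex \<Rightarrow> complex \<Rightarrow> 'i set \<Rightarrow> complex \<Rightarrow> 'i
    set \<Rightarrow> 'i \<Rightarrow> complex" where
  "subset_residue x A B a X z S i = (let N = Suc (card S) in
     T (1 / q) * T (A / (a * q ^ N) * z) * T (B / q ^ N * z) * pf_kernel (a * q ^ (2 * N)) (x i) z
     * T (A * x i) * T (a * q ^ Suc (card X) * B * x i)
     * (\<Prod>j\<in>S. theta_ratio (x j) (x i)) * (\<Prod>j\<in>X - insert i S. theta_ratio (x i) (x j))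
     * (\<Prod>l\<in>S. \<Prod>j\<in>X - insert i S. theta_ratio (x l) (x j))
     * (\<Prod>j\<in>X - insert i S. outer_factor A B N (x j))
         * (\<Prod>j\<in>S. inner_factor A B a (Suc (card X)) N (x j)))"

text \<open>The new point lies outside \<open>S\<close>, and \<open>z = x w\<close> meets the points
  of \<open>S\<close> through \<open>T (A * z)\<close> times theta ratios. In
  \<open>partial_fractions_low\<close> the part from \<open>1 / k\<close> carries the factors
  \<open>T (k * x i / q) / T (k * x i)\<close>, which turn \<open>inner_factor\<close> for
  \<open>a\<close> into the one for \<open>a * q\<close>.\<close>

lemma subset_term_insert_low:
  fixes x :: "'i \<Rightarrow> complex"
  assumes X: "finite X" "S \<subseteq> X" "w \<notin> X"
    and nz: "A \<noteq> 0" "a \<noteq> 0" "\<And>i. i \<in> insert w X \<Longrightarrow> x i \<noteq> 0"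
    and gen: "\<And>i. T (a * q ^ i) \<noteq> 0" "\<And>i N. i \<in> insert w X \<Longrightarrow> T (A / (a * q ^ N) * x i) \<noteq> 0"
    and x_x: "\<And>i j. i \<in> insert w X \<Longrightarrow> j \<in> insert w X \<Longrightarrow> i \<noteq> j \<Longrightarrow> T (x i / x j) \<noteq> 0"
  shows "subset_term x A B a (insert w X) S =
    T (a * q ^ card S) / T (a * q ^ (2 * card S)) *
      (T (A * q ^ card S * x w) * T (B / q ^ card S * x w)) * subset_term x A B (a * q) X S
    - (\<Sum>i\<in>S. subset_residue x A B a X (x w) (S - {i}) i)"
proof -
  define N where "N = card S"
  define k where "k = A / (a * q ^ N)"
  define W where "W = (\<Prod>i\<in>S. \<Prod>j\<in>X - S. theta_ratio (x i) (x j))"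
  define Psi where "Psi = (\<Prod>j\<in>X - S. outer_factor A B N (x j))"
  define Phi where "Phi = (\<Prod>i\<in>S. inner_factor A B a (Suc (card X)) N (x i))"
  have fin: "finite S" using X finite_subset by blast
  have sub: "insert w X - S = insert w (X - S)" "w \<notin> X - S" "w \<notin> S" "finite (X - S)" using X by auto
  have "subset_term x A B a (insert w X) S =
      (\<Prod>i\<in>S. theta_ratio (x i) (x w)) * W * (outer_factor A B N (x w) * Psi) * Phi"
    using sub X by (simp add: subset_term_def W_def Psi_def Phi_def N_def prod.distrib)
  also have "\<dots> = (T (A * x w) * (\<Prod>i\<in>S. theta_ratio (x i) (x w))) * (T (B / q ^ N * x w) * W * Psi
      * Phi)"
    by (simp add: outer_factor_def mult_ac)
  also have "T (A * x w) * (\<Prod>i\<in>S. theta_ratio (x i) (x w)) =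
    T (a * q ^ card S) / T (a * q ^ (2 * card S)) * T (A * q ^ card S * x w) *
      (\<Prod>i\<in>S. T (k * x i / q) / T (k * x i))
    - (\<Sum>i\<in>S. T (1 / q) * T (k * x w) * pf_kernel (a * q ^ (2 * card S)) (x i) (x w) * T (A
        * x i) / T (k * x i)
        * (\<Prod>j\<in>S - {i}. theta_ratio (x j) (x i)))"
  proof (rule partial_fractions_low)
    show "T (x i / x j) \<noteq> 0" if "i \<in> S" "j \<in> S" "i \<noteq> j" for i j
      using that X by (intro x_x) auto
    show "T (x w / x i) \<noteq> 0" if "i \<in> S" for i
      using that X by (intro x_x) auto
    show "T (k * x w) \<noteq> 0" unfolding k_def using gen(2) by blast
    show "T (k * x i) \<noteq> 0" if "i \<in> S" for i unfolding k_def using gen(2) X that by blast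
  qed (use nz X gen(1) fin in \<open>auto simp: k_def N_def\<close>)
  also have "\<dots> * (T (B / q ^ N * x w) * W * Psi * Phi) =
      T (a * q ^ N) / T (a * q ^ (2 * N)) * (T (A * q ^ N * x w) * T (B / q ^ N * x w))
        * (W * Psi * ((\<Prod>i\<in>S. T (k * x i / q) / T (k * x i)) * Phi))
      - (\<Sum>i\<in>S. T (1 / q) * T (k * x w) * pf_kernel (a * q ^ (2 * N)) (x i) (x w) * T (A
          * x i) / T (k * x i)
        * (\<Prod>j\<in>S - {i}. theta_ratio (x j) (x i)) * (T (B / q ^ N * x w) * W * Psi * Phi))"
    by (simp only: left_diff_distrib sum_distrib_right N_def) (simp add: mult_ac)
  also have "W * Psi * ((\<Prod>i\<in>S. T (k * x i / q) / T (k * x i)) * Phi) = subset_term x A B (a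
      * q) X S"
  proof -
    have "(\<Prod>i\<in>S. T (k * x i / q) / T (k * x i)) * Phi = (\<Prod>i\<in>S. T (k * x i / q) / T (k * x i)
        * inner_factor A B a (Suc (card X)) N (x i))"
      by (simp only: Phi_def prod.distrib)
    also have "\<dots> = (\<Prod>i\<in>S. inner_factor A B (a * q) (card X) N (x i))"
    proof (rule prod.cong[OF refl])
      fix i assume "i \<in> S"
      then have "T (k * x i) \<noteq> 0" using gen(2)[of i N] X by (auto simp: k_def)
      then show "T (k * x i / q) / T (k * x i) * inner_factor A B a (Suc (card X)) N (x i) =
          inner_factor A B (a * q) (card X) N (x i)"
        by (simp add: inner_factor_def k_def mult_ac)
    qed
    finally show ?thesis by (simp add: subset_term_def W_def Psi_def N_def)
  qed
  also have "(\<Sum>i\<in>S. T (1 / q) * T (k * x w) * pf_kernel (a * q ^ (2 * N)) (x i) (x w) * T (A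
      * x i) / T (k * x i)
        * (\<Prod>j\<in>S - {i}. theta_ratio (x j) (x i)) * (T (B / q ^ N * x w) * W * Psi * Phi)) =
      (\<Sum>i\<in>S. subset_residue x A B a X (x w) (S - {i}) i)"
  proof (rule sum.cong[OF refl])
    fix i assume i: "i \<in> S"
    \<comment> \<open>\<open>subset_residue\<close> is indexed by the set without \<open>i\<close>
      but counts \<open>i\<close>; this lets it match the residues of the other insertion.\<close>
    have N: "Suc (card (S - {i})) = N" using i fin by (metis N_def card.remove)
    have Xi: "X - insert i (S - {i}) = X - S" using i by auto
    have T_nz: "T (k * x i) \<noteq> 0" using gen(2)[of i N] X i by (auto simp: k_def)
    have W: "W = (\<Prod>j\<in>X - S. theta_ratio (x i) (x j)) * (\<Prod>l\<in>S - {i}. \<Prod>j\<in>X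
        - S. theta_ratio (x l) (x j))"
      unfolding W_def by (rule prod.remove[OF fin i])
    have Phi: "Phi = inner_factor A B a (Suc (card X)) N (x i) * (\<Prod>j\<in>S
        - {i}. inner_factor A B a (Suc (card X)) N (x j))"
      unfolding Phi_def by (rule prod.remove[OF fin i])
    show "T (1 / q) * T (k * x w) * pf_kernel (a * q ^ (2 * N)) (x i) (x w) * T (A * x i) / T (k
        * x i)
        * (\<Prod>j\<in>S - {i}. theta_ratio (x j) (x i)) * (T (B / q ^ N * x w) * W * Psi * Phi) =
            subset_residue x A B a X (x w) (S - {i}) i"
      unfolding subset_residue_def Let_def N Xi W Phi Psi_def inner_factor_def[of _ _ _ _ _ "x i"]
          k_def[symmetric]
      using T_nz by (simp add: mult_ac)
  qed
  finally show ?thesis by (simp add: N_def)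
qed

text \<open>The new point lies inside, so it meets the points of \<open>X - S\<close>. With
  \<open>k = B / q ^ N\<close> the part from \<open>1 / k\<close> lowers the exponent
  \<open>N\<close> in \<open>outer_factor\<close> to \<open>card S\<close>, and the kernel parameter
  is again \<open>a * q ^ (2 * N)\<close>, \<open>N\<close> being the size of the enlarged
  set.\<close>

lemma subset_term_insert_high:
  fixes x :: "'i \<Rightarrow> complex"
  assumes X: "finite X" "S \<subseteq> X" "w \<notin> X"
    and nz: "A \<noteq> 0" "a \<noteq> 0" "B \<noteq> 0" "\<And>i. i \<in> insert w X \<Longrightarrow> x i \<noteq> 0"
    and gen: "\<And>i. T (a * q ^ i) \<noteq> 0" "\<And>i N. i \<in> insert w X \<Longrightarrow> T (B / q ^ N * x i) \<noteq> 0"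
    and x_x: "\<And>i j. i \<in> insert w X \<Longrightarrow> j \<in> insert w X \<Longrightarrow> i \<noteq> j \<Longrightarrow> T (x i / x j) \<noteq> 0"
  shows "subset_term x A B a (insert w X) (insert w S) =
    T (a * q ^ (card X + card S + 2)) / T (a * q ^ (2 * Suc (card S))) / q ^ (card X - card S) *
      (T (A / (a * q ^ Suc (card S)) * x w) * T (a * q ^ Suc (card S) * B * x w))
          * subset_term x A B (a * q) X S
    + (\<Sum>i\<in>X - S. subset_residue x A B a X (x w) S i)"
proof -
  define N where "N = Suc (card S)"
  define k where "k = B / q ^ N"
  define A' where "A' = a * q ^ Suc (card X) * B"
  define W where "W = (\<Prod>i\<in>S. \<Prod>j\<in>X - S. theta_ratio (x i) (x j))"
  define Psi where "Psi = (\<Prod>j\<in>X - S. outer_factor A B N (x j))"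
  define Phi where "Phi = (\<Prod>i\<in>S. inner_factor A B a (Suc (card X)) N (x i))"
  have fin: "finite S" "finite (X - S)" using X finite_subset by blast+
  have sub: "insert w X - insert w S = X - S" "w \<notin> S" using X by auto
  have card_le: "card S \<le> card X" using X by (simp add: card_mono)
  have card_diff: "card (X - S) = card X - card S" using X fin by (simp add: card_Diff_subset)
  \<comment> \<open>The parameters passed through on the way are all of the form
    \<open>a * q ^ i\<close>, where \<open>T\<close> is nonzero by hypothesis.\<close>
  have A'_k: "A' / (k * q ^ j) = a * q ^ (Suc (card X) + N - j)" if "j \<le> card X - card S" for j
  proof -
    have "q ^ (Suc (card X) + N) = q ^ (Suc (card X) + N - j) * q ^ j"
      using that by (simp flip: power_add)
    then show ?thesis
      using nz q_nz by (simp add: A'_def k_def power_add field_simps)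
  qed
  have s: "A' / (k * q ^ card (X - S)) = a * q ^ (2 * N)"
  proof -
    have "Suc (card X) + N - (card X - card S) = 2 * N" using card_le by (simp add: N_def)
    then show ?thesis using A'_k[of "card X - card S"] by (simp only: card_diff order_refl)
  qed
  have "subset_term x A B a (insert w X) (insert w S) =
      (\<Prod>j\<in>X - S. theta_ratio (x w) (x j)) * W * Psi * (inner_factor A B a (Suc (card X)) N (x w)
          * Phi)"
    using sub fin X by (simp add: subset_term_def W_def Psi_def Phi_def N_def)
  also have "\<dots> = (T (A' * x w) * (\<Prod>j\<in>X - S. theta_ratio (x w) (x j))) * (T (A / (a * q ^ N) * x w)
      * W * Psi * Phi)"
    by (simp add: inner_factor_def A'_def mult_ac)
  also have "T (A' * x w) * (\<Prod>j\<in>X - S. theta_ratio (x w) (x j)) =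
    T (A' / k) / T (a * q ^ (2 * N)) * T (a * q ^ (2 * N) * k * x w) * (\<Prod>i\<in>X - S. T (k * q
        * x i) / T (k * x i)) / q ^ card (X - S)
    + (\<Sum>i\<in>X - S. T (1 / q) * T (k * x w) * pf_kernel (a * q ^ (2 * N)) (x i) (x w) * T (A'
        * x i) / T (k * x i)
        * (\<Prod>j\<in>X - S - {i}. theta_ratio (x i) (x j)))"
  proof (rule partial_fractions_high)
    show "T (A' / (k * q ^ i)) \<noteq> 0" if "i \<le> card (X - S)" for i
      using that gen(1) by (simp only: card_diff A'_k not_False_eq_True)
    show "T (k * x w) \<noteq> 0" unfolding k_def using gen(2) by blast
    show "T (k * x i) \<noteq> 0" if "i \<in> X - S" for i unfolding k_def using gen(2) that by blast
    show "T (x i / x j) \<noteq> 0" if "i \<in> X - S" "j \<in> X - S" "i \<noteq> j" for i j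
      using that X by (intro x_x) auto
    show "T (x w / x i) \<noteq> 0" if "i \<in> X - S" for i
      using that X by (intro x_x) auto
  qed (use nz X fin q_nz s in \<open>auto simp: k_def A'_def\<close>)
  also have "\<dots> * (T (A / (a * q ^ N) * x w) * W * Psi * Phi) =
      T (A' / k) / T (a * q ^ (2 * N)) / q ^ (card X - card S) * (T (A / (a * q ^ N) * x w) * T (a
          * q ^ (2 * N) * k * x w))
        * (W * ((\<Prod>i\<in>X - S. T (k * q * x i) / T (k * x i)) * Psi) * Phi)
      + (\<Sum>i\<in>X - S. T (1 / q) * T (k * x w) * pf_kernel (a * q ^ (2 * N)) (x i) (x w) * T (A'
          * x i) / T (k * x i)
        * (\<Prod>j\<in>X - S - {i}. theta_ratio (x i) (x j)) * (T (A / (a * q ^ N) * x w) * W * Psi * Phi))"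
    by (simp only: distrib_right sum_distrib_right card_diff) (simp add: mult_ac)
  also have "W * ((\<Prod>i\<in>X - S. T (k * q * x i) / T (k * x i)) * Psi) * Phi = subset_term x A B (a
      * q) X S"
  proof -
    have "(\<Prod>i\<in>X - S. T (k * q * x i) / T (k * x i)) * Psi = (\<Prod>i\<in>X - S. T (k * q * x i) / T (k * x i)
        * outer_factor A B N (x i))"
      by (simp only: Psi_def prod.distrib)
    also have "\<dots> = (\<Prod>i\<in>X - S. outer_factor A B (card S) (x i))"
    proof (rule prod.cong[OF refl])
      fix i assume "i \<in> X - S"
      then have "T (k * x i) \<noteq> 0" unfolding k_def using gen(2) by blast
      moreover have "k * q = B / q ^ card S" using q_nz by (simp add: k_def N_def)
      ultimately show "T (k * q * x i) / T (k * x i) * outer_factor A B N (x i) =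
          outer_factor A B (card S) (x i)"
        by (simp add: outer_factor_def flip: k_def)
    qed
    moreover have "Phi = (\<Prod>i\<in>S. inner_factor A B (a * q) (card X) (card S) (x i))"
      by (simp add: Phi_def inner_factor_def N_def mult_ac)
    ultimately show ?thesis by (simp add: subset_term_def W_def)
  qed
  also have "(\<Sum>i\<in>X - S. T (1 / q) * T (k * x w) * pf_kernel (a * q ^ (2 * N)) (x i) (x w) * T (A'
      * x i) / T (k * x i)
        * (\<Prod>j\<in>X - S - {i}. theta_ratio (x i) (x j)) * (T (A / (a * q ^ N) * x w) * W * Psi * Phi)) =
      (\<Sum>i\<in>X - S. subset_residue x A B a X (x w) S i)"
  proof (rule sum.cong[OF refl])
    fix i assume i: "i \<in> X - S"
    have Xi: "X - insert i S = X - S - {i}" by auto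
    have T_nz: "T (k * x i) \<noteq> 0" unfolding k_def using gen(2) i by blast
    have W: "W = (\<Prod>l\<in>S. theta_ratio (x l) (x i)) * (\<Prod>l\<in>S. \<Prod>j\<in>X - S - {i}. theta_ratio (x l) (x j))"
      unfolding W_def prod.remove[OF fin(2) i] by (simp add: prod.distrib)
    have Psi: "Psi = outer_factor A B N (x i) * (\<Prod>j\<in>X - S - {i}. outer_factor A B N (x j))"
      unfolding Psi_def by (rule prod.remove[OF fin(2) i])
    show "T (1 / q) * T (k * x w) * pf_kernel (a * q ^ (2 * N)) (x i) (x w) * T (A' * x i) / T (k
        * x i)
        * (\<Prod>j\<in>X - S - {i}. theta_ratio (x i) (x j)) * (T (A / (a * q ^ N) * x w) * W * Psi * Phi) =
            subset_residue x A B a X (x w) S i"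
      unfolding subset_residue_def Let_def N_def[symmetric] Xi W Psi Phi_def outer_factor_def[of _ _
          _ "x i"] k_def[symmetric] A'_def[symmetric]
      using T_nz by (simp add: mult_ac)
  qed
  also have "A' / k = a * q ^ (card X + card S + 2)"
    using A'_k[of 0] by (simp add: N_def)
  also have "a * q ^ (2 * N) * k = a * q ^ N * B"
    using q_nz by (simp add: k_def mult_2 power_add)
  finally show ?thesis by (simp add: N_def)
qed

text \<open>The addition formula for pairs with constant \<open>b * c\<close> at the four points
  \<open>A * z\<close>, \<open>b\<close>, \<open>u = a * q ^ Suc N\<close> and
  \<open>v = b * c * q ^ N\<close>. Each of its six pairs is, up to a monomial, one of the theta
  products of the claim.\<close>

lemma basis_step:
  assumes nz: "a \<noteq> 0" "b \<noteq> 0" "c \<noteq> 0" "A \<noteq> 0" "B \<noteq> 0" "z \<noteq> 0" and A: "A = B * (b * c)"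
  shows "T (A * q ^ N * z) * T (B / q ^ N * z) * (T (a * q ^ Suc N / b) * T (a * q ^ Suc N / c))
      - a * q / (b * c) * (T (A / (a * q ^ Suc N) * z) * T (a * q ^ Suc N * B * z)) * (T (b * q ^ N)
          * T (c * q ^ N))
    = T (a * q / (b * c)) * T (a * q ^ Suc (2 * N)) * (T (A / b * z) * T (B * b * z))"
proof -
  define u v P where "u = a * q ^ Suc N" and "v = b * c * q ^ N" and "P = b * c"
  have uv_nz: "u \<noteq> 0" "v \<noteq> 0" "P \<noteq> 0" "A * z \<noteq> 0" using nz q_nz by (simp_all add: u_def v_def P_def)
  have theta_pair: "theta_pair P (A * z) b * theta_pair P u v = theta_pair P (A * z) v
      * theta_pair P u b - v / u * theta_pair P (A * z) u * theta_pair P v b"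
    using uv_nz nz by (intro theta_pair_addition)
  have 1: "theta_pair P (A * z) b = - (b / (A * z)) * (T (A / b * z) * T (B * b * z))"
    using nz uv_nz T_flip[of b "A * z"] by (simp add: theta_pair_def P_def A mult_ac)
  have 2: "theta_pair P u v = - (v / u) * (T (a * q / (b * c)) * T (a * q ^ Suc (2 * N)))"
  proof -
    have "u / v = a * q / (b * c)" "v * u / P = a * q ^ Suc (2 * N)"
      using nz q_nz by (simp_all add: u_def v_def P_def mult_2 power_add)
    then show ?thesis using T_flip[of v u] uv_nz by (simp add: theta_pair_def mult_ac)
  qed
  have 3: "theta_pair P (A * z) v = - (v / (A * z)) * (T (A * q ^ N * z) * T (B / q ^ N * z))"
  proof -
    have "A * z / v = B / q ^ N * z" "v * (A * z) / P = A * q ^ N * z"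
      using nz q_nz by (simp_all add: v_def P_def A)
    then show ?thesis using T_flip[of v "A * z"] uv_nz by (simp add: theta_pair_def mult_ac)
  qed
  have 4: "theta_pair P u b = - (b / u) * (T (a * q ^ Suc N / b) * T (a * q ^ Suc N / c))"
  proof -
    have "u / b = a * q ^ Suc N / b" "b * u / P = a * q ^ Suc N / c"
      using nz by (simp_all add: u_def P_def)
    then show ?thesis using T_flip[of b u] uv_nz nz by (simp add: theta_pair_def mult_ac)
  qed
  have 5: "theta_pair P (A * z) u = - (u / (A * z)) * (T (A / (a * q ^ Suc N) * z) * T (a
      * q ^ Suc N * B * z))"
  proof -
    have "A * z / u = A / (a * q ^ Suc N) * z" "u * (A * z) / P = a * q ^ Suc N * B * z"
      using nz by (simp_all add: u_def P_def A)
    then show ?thesis using T_flip[of u "A * z"] uv_nz by (simp add: theta_pair_def mult_ac)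
  qed
  have 6: "theta_pair P v b = - (b / v) * (T (b * q ^ N) * T (c * q ^ N))"
  proof -
    have "v / b = c * q ^ N" "b * v / P = b * q ^ N"
      using nz by (simp_all add: v_def P_def)
    then show ?thesis using T_flip[of b v] uv_nz nz by (simp add: theta_pair_def mult_ac)
  qed
  have vu: "u / v = a * q / (b * c)" using nz q_nz by (simp add: u_def v_def)
  \<comment> \<open>The six theta products become variables, so that only monomials have to be
    cleared.\<close>
  have aux: "p3 * p4 - u / v * p5 * p6 = p2 * p1"
    if "- (b / (A * z)) * p1 * (- (v / u) * p2) =
      - (v / (A * z)) * p3 * (- (b / u) * p4) - v / u * (- (u / (A * z)) * p5) * (- (b / v) * p6)"
    for p1 p2 p3 p4 p5 p6
  proof -
    have "b * v / (A * z * u) * (p3 * p4 - u / v * p5 * p6) =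
      - (v / (A * z)) * p3 * (- (b / u) * p4) - v / u * (- (u / (A * z)) * p5) * (- (b / v) * p6)"
      using nz uv_nz by (simp add: field_simps)
    also have "\<dots> = b * v / (A * z * u) * (p2 * p1)"
      unfolding that[symmetric] by simp
    finally show ?thesis using nz uv_nz by simp
  qed
  show ?thesis
    using aux[OF theta_pair[unfolded 1 2 3 4 5 6]] unfolding vu .
qed

text \<open>The recurrence that dictates the form of \<open>coeff\<close>. All three coefficients
  share the factor \<open>H\<close>, and after its removal \<open>basis_step\<close> is
  left.\<close>

lemma coeff_step:
  assumes nz: "a \<noteq> 0" "b \<noteq> 0" "c \<noteq> 0" "A \<noteq> 0" "B \<noteq> 0" "z \<noteq> 0" and A: "A = B * (b * c)" and "N \<le> M"
    and gen: "\<And>i. T (a * q ^ i) \<noteq> 0" "\<And>i. T (a * q ^ i / (b * c)) \<noteq> 0"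
  shows "coeff b c a (Suc M) N * (T (a * q ^ N) / T (a * q ^ (2 * N)) * (T (A * q ^ N * z)
      * T (B / q ^ N * z)))
    + coeff b c a (Suc M) (Suc N) * (T (a * q ^ (M + N + 2)) / T (a * q ^ (2 * Suc N)) / q ^ (M - N)
        * (T (A / (a * q ^ Suc N) * z) * T (a * q ^ Suc N * B * z)))
    = coeff b c (a * q) M N * (T (A / b * z) * T (B * b * z))"
proof -
  obtain d where d: "M = N + d" using \<open>N \<le> M\<close> le_Suc_ex by blast
  define H where "H = ((- a / (b * c)) ^ N * q ^ (N * Suc M) / q ^ (N choose 2))
     * (pp b N * pp c N * pp (a * q ^ Suc (Suc N) / b) d * pp (a * q ^ Suc (Suc N) / c) d)
     / (pp (a * q ^ Suc N) (Suc M) * pp (a * q / (b * c)) (Suc M))"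
  have pp_nz: "pp (a * q ^ j) k \<noteq> 0" "pp (a * q ^ j / (b * c)) k \<noteq> 0" for j k
  proof -
    have "T (a * q ^ j * q ^ i) \<noteq> 0" "T (a * q ^ j / (b * c) * q ^ i) \<noteq> 0" for i
      using gen(1)[of "j + i"] gen(2)[of "j + i"] by (simp_all add: power_add mult.assoc)
    then show "pp (a * q ^ j) k \<noteq> 0" "pp (a * q ^ j / (b * c)) k \<noteq> 0"
      by (simp_all only: ell_fact_def prod_zero_iff finite_lessThan) simp_all
  qed
  have 1: "coeff b c a (Suc M) N * (T (a * q ^ N) / T (a * q ^ (2 * N)))
      = H * (T (a * q ^ Suc N / b) * T (a * q ^ Suc N / c))"
  proof -
    have "pp (a * q ^ N) (Suc (Suc M)) = T (a * q ^ N) * pp (a * q ^ Suc N) (Suc M)"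
      by (subst pp_Suc') (simp add: mult_ac)
    moreover have "pp (a * q ^ Suc N / e) (Suc M - N) = T (a * q ^ Suc N / e) * pp (a
        * q ^ Suc (Suc N) / e) d" for e
      using pp_Suc'[of "a * q ^ Suc N / e" d] by (simp add: d Suc_diff_le mult_ac)
    ultimately show ?thesis
      using gen by (simp add: coeff_def H_def mult_ac del: power_Suc)
  qed
  have 2: "coeff b c a (Suc M) (Suc N) * (T (a * q ^ (M + N + 2)) / T (a * q ^ (2 * Suc N)) / q ^ (M
      - N))
      = - (H * (a * q / (b * c)) * (T (b * q ^ N) * T (c * q ^ N)))"
  proof -
    have e1: "pp (a * q ^ Suc N) (Suc (Suc M)) = pp (a * q ^ Suc N) (Suc M) * T (a * q ^ (M + N
        + 2))"
      by (subst pp_Suc) (simp add: power_add mult_ac)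
    have e2: "Suc M - Suc N = d" "M - N = d" by (simp_all add: d)
    \<comment> \<open>The power \<open>q ^ (M - N)\<close> comes from
      \<open>subset_term_insert_high\<close>; it is absorbed by the quadratic exponents of
      \<open>q\<close> in \<open>coeff\<close>.\<close>
    have e3: "q ^ (Suc N * Suc M) / q ^ (Suc N choose 2) / q ^ d = q * (q ^ (N
        * Suc M) / q ^ (N choose 2))"
    proof -
      have "Suc N * Suc M + (N choose 2) = Suc (N * Suc M) + (Suc N choose 2) + d"
        by (simp add: d numeral_2_eq_2)
      then have "q ^ (Suc N * Suc M) * q ^ (N choose 2) = q * q ^ (N * Suc M) * q ^ (Suc N choose 2)
          * q ^ d"
        by (simp only: power_add[symmetric] power_Suc[symmetric])
      then show ?thesis using q_nz by (simp add: field_simps del: mult_Suc mult_Suc_right)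
    qed
    have "coeff b c a (Suc M) (Suc N) * (T (a * q ^ (M + N + 2)) / T (a * q ^ (2 * Suc N)) / q ^ (M
        - N)) =
      1 / (pp (a * q ^ Suc N) (Suc M) * pp (a * q / (b * c)) (Suc M)) * (- a / (b * c)) ^ Suc N
       * (q ^ (Suc N * Suc M) / q ^ (Suc N choose 2) / q ^ d)
     * (pp b (Suc N) * pp c (Suc N) * pp (a * q ^ Suc (Suc N) / b) d * pp (a
         * q ^ Suc (Suc N) / c) d)"
      unfolding coeff_def e1 e2 using gen(1)[of "M + N + 2"] gen(1)[of "2 * Suc N"]
      by (simp del: power_Suc mult_Suc mult_Suc_right add: mult_ac)
    then show ?thesis
      unfolding e3 H_def by (simp add: pp_Suc mult_ac del: mult_Suc mult_Suc_right)
  qed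
  have 3: "coeff b c (a * q) M N = H * (T (a * q / (b * c)) * T (a * q ^ Suc (2 * N)))"
  proof -
    have e1: "pp (a * q / (b * c)) (Suc M) = T (a * q / (b * c)) * pp (a * q * q / (b * c)) M"
      by (subst pp_Suc') (simp add: mult_ac)
    have e2: "a * q * q ^ j = a * q ^ Suc j" for j by simp
    have e3: "(- (a * q) / (b * c)) ^ N * q ^ (N * M) = (- a / (b * c)) ^ N * q ^ (N * Suc M)"
    proof -
      have "- (a * q) / (b * c) = - a / (b * c) * q" by simp
      then show ?thesis by (simp only: power_mult_distrib) (simp add: power_add mult_ac)
    qed
    have e4: "M - N = d" by (simp add: d)
    have "T (a * q / (b * c)) \<noteq> 0" using gen(2)[of 1] by simp
    then show ?thesis
      unfolding coeff_def e2 e3 H_def e1 e4 by (simp add: mult_ac del: power_Suc mult_Suc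
          mult_Suc_right)
  qed
  have "?thesis \<longleftrightarrow> H * (T (A * q ^ N * z) * T (B / q ^ N * z) * (T (a * q ^ Suc N / b) * T (a
      * q ^ Suc N / c))
      - a * q / (b * c) * (T (A / (a * q ^ Suc N) * z) * T (a * q ^ Suc N * B * z)) * (T (b * q ^ N)
          * T (c * q ^ N)))
    = H * (T (a * q / (b * c)) * T (a * q ^ Suc (2 * N)) * (T (A / b * z) * T (B * b * z)))"
    unfolding mult.assoc[symmetric, of "coeff _ _ _ _ _"] 1 2 3 by (simp add: algebra_simps)
  then show ?thesis
    using basis_step[OF nz A, of N] by simp
qed

text \<open>The parameter \<open>a\<close> is arbitrary in the induction because the smaller set is
  expanded with \<open>a * q\<close>; the hypotheses run over all powers of \<open>q\<close> and so
  are inherited.\<close>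

theorem product_expansion_generic:
  fixes x :: "'i \<Rightarrow> complex"
  assumes "finite X" and nz: "a \<noteq> 0" "b \<noteq> 0" "c \<noteq> 0" "A \<noteq> 0" "B \<noteq> 0" and A: "A = B * (b * c)"
    and "\<And>i. i \<in> X \<Longrightarrow> x i \<noteq> 0"
    and "\<And>i. T (a * q ^ i) \<noteq> 0" "\<And>i. T (a * q ^ i / (b * c)) \<noteq> 0"
    and "\<And>i N. i \<in> X \<Longrightarrow> T (A / (a * q ^ N) * x i) \<noteq> 0" "\<And>i N. i \<in> X \<Longrightarrow> T (B / q ^ N * x i) \<noteq> 0"
    and "\<And>i j. i \<in> X \<Longrightarrow> j \<in> X \<Longrightarrow> i \<noteq> j \<Longrightarrow> T (x i / x j) \<noteq> 0"
  shows "(\<Prod>i\<in>X. T (A / b * x i) * T (B * b * x i)) =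
    (\<Sum>S\<in>Pow X. coeff b c a (card X) (card S) * subset_term x A B a X S)"
  using assms
proof (induction X arbitrary: a rule: finite_induct)
  case empty
  then have "T a \<noteq> 0" using empty.prems(8)[of 0] by simp
  then show ?case by (simp add: coeff_def subset_term_def pp_Suc binomial_eq_0)
next
  case (insert w X)
  define M where "M = card X"
  define F where "F S i = coeff b c a (Suc M) (Suc (card S))
      * subset_residue x A B a X (x w) S i" for S i
  have gen': "T (a * q * q ^ i) \<noteq> 0" "T (a * q * q ^ i / (b * c)) \<noteq> 0" for i
    using insert.prems(8)[of "Suc i"] insert.prems(9)[of "Suc i"] by (simp_all add: mult_ac)
  have gen'': "T (A / (a * q * q ^ N) * x i) \<noteq> 0" if "i \<in> X" for i N
    using insert.prems(10)[of i "Suc N"] that by (simp add: mult_ac)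
  have IH: "(\<Prod>i\<in>X. T (A / b * x i) * T (B * b * x i)) =
    (\<Sum>S\<in>Pow X. coeff b c (a * q) M (card S) * subset_term x A B (a * q) X S)"
    unfolding M_def
  proof (rule insert.IH)
    show "T (x i / x j) \<noteq> 0" if "i \<in> X" "j \<in> X" "i \<noteq> j" for i j
      using that by (intro insert.prems(12)) auto
    show "T (B / q ^ N * x i) \<noteq> 0" if "i \<in> X" for i N
      using that by (intro insert.prems(11)) auto
  qed (use insert.prems(1-7) q_nz gen' gen'' in auto)
  have card: "card (insert w X) = Suc M" using insert(1,2) by (simp add: M_def)
  \<comment> \<open>The subsets of \<open>insert w X\<close> are taken in pairs \<open>S\<close>,
    \<open>insert w S\<close>; the two residue sums that remain cancel only after summation over
    \<open>S\<close>.\<close>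
  have step: "coeff b c a (Suc M) (card S) * subset_term x A B a (insert w X) S
      + coeff b c a (Suc M) (card (insert w S)) * subset_term x A B a (insert w X) (insert w S)
    = T (A / b * x w) * T (B * b * x w) * (coeff b c (a * q) M (card S) * subset_term x A B (a
        * q) X S)
      - (\<Sum>i\<in>S. F (S - {i}) i) + (\<Sum>i\<in>X - S. F S i)" if "S \<in> Pow X" for S
  proof -
    have S: "S \<subseteq> X" "finite S" "w \<notin> S" using that insert(1,2) finite_subset by auto
    have cS: "card (insert w S) = Suc (card S)" using S by simp
    have le: "card S \<le> M" using S insert(1) by (simp add: M_def card_mono)
    have low: "subset_term x A B a (insert w X) S =
      T (a * q ^ card S) / T (a * q ^ (2 * card S)) *
        (T (A * q ^ card S * x w) * T (B / q ^ card S * x w)) * subset_term x A B (a * q) X S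
      - (\<Sum>i\<in>S. subset_residue x A B a X (x w) (S - {i}) i)"
      by (rule subset_term_insert_low) (use insert.prems insert(1,2) S in blast)+
    have high: "subset_term x A B a (insert w X) (insert w S) =
      T (a * q ^ (M + card S + 2)) / T (a * q ^ (2 * Suc (card S))) / q ^ (M - card S) *
        (T (A / (a * q ^ Suc (card S)) * x w) * T (a * q ^ Suc (card S) * B * x w))
            * subset_term x A B (a * q) X S
      + (\<Sum>i\<in>X - S. subset_residue x A B a X (x w) S i)"
      unfolding M_def
      by (rule subset_term_insert_high) (use insert.prems insert(1,2) S in blast)+
    have main: "coeff b c a (Suc M) (card S) * (T (a * q ^ card S) / T (a * q ^ (2 * card S))
        * (T (A * q ^ card S * x w) * T (B / q ^ card S * x w)))
    + coeff b c a (Suc M) (Suc (card S)) * (T (a * q ^ (M + card S + 2)) / T (a * q ^ (2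
        * Suc (card S))) / q ^ (M - card S)
        * (T (A / (a * q ^ Suc (card S)) * x w) * T (a * q ^ Suc (card S) * B * x w)))
    = coeff b c (a * q) M (card S) * (T (A / b * x w) * T (B * b * x w))"
      by (rule coeff_step) (use insert.prems le in auto)
    have F_low: "(\<Sum>i\<in>S. F (S - {i}) i) = coeff b c a (Suc M) (card S)
        * (\<Sum>i\<in>S. subset_residue x A B a X (x w) (S - {i}) i)"
      unfolding F_def sum_distrib_left
      by (intro sum.cong refl) (metis S(2) card.remove)
    have F_high: "(\<Sum>i\<in>X - S. F S i) = coeff b c a (Suc M) (Suc (card S)) * (\<Sum>i\<in>X
        - S. subset_residue x A B a X (x w) S i)"
      by (simp add: F_def sum_distrib_left)
    have alg: "c1 * (m1 * t - r1) + c2 * (m2 * t + r2) = e * (k * t) - c1 * r1 + c2 * r2"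
      if "c1 * m1 + c2 * m2 = k * e" for c1 c2 m1 m2 t r1 r2 e k :: complex
    proof -
      have "c1 * (m1 * t - r1) + c2 * (m2 * t + r2) = (c1 * m1 + c2 * m2) * t - c1 * r1 + c2 * r2"
        by (simp add: algebra_simps)
      then show ?thesis by (simp add: that mult_ac)
    qed
    show ?thesis
      unfolding cS low high F_low F_high by (rule alg[OF main])
  qed
  have "(\<Sum>S\<in>Pow (insert w X). coeff b c a (Suc M) (card S) * subset_term x A B a (insert w X) S) =
    (\<Sum>S\<in>Pow X. T (A / b * x w) * T (B * b * x w) * (coeff b c (a * q) M (card S)
        * subset_term x A B (a * q) X S)
      - (\<Sum>i\<in>S. F (S - {i}) i) + (\<Sum>i\<in>X - S. F S i))"
    unfolding sum_Pow_insert[OF insert(1,2)] by (intro sum.cong step refl)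
  also have "\<dots> = T (A / b * x w) * T (B * b * x w) * (\<Sum>S\<in>Pow X. coeff b c (a * q) M (card S)
      * subset_term x A B (a * q) X S)
     - (\<Sum>S\<in>Pow X. \<Sum>i\<in>S. F (S - {i}) i) + (\<Sum>S\<in>Pow X. \<Sum>i\<in>X - S. F S i)"
    by (simp add: sum.distrib sum_subtractf sum_distrib_left)
  also have "\<dots> = T (A / b * x w) * T (B * b * x w) * (\<Sum>S\<in>Pow X. coeff b c (a * q) M (card S)
      * subset_term x A B (a * q) X S)"
    by (simp add: sum_Pow_swap[OF insert(1)])
  also have "\<dots> = (\<Prod>i\<in>insert w X. T (A / b * x i) * T (B * b * x i))"
    unfolding IH[symmetric] using insert(1,2) by simp
  finally show ?case unfolding card by simp
qed


text \<open>Here the denominators of \<^term>\<open>coeff\<close> that the hypotheses do not keep from vanishing are cleared.\<close>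

definition cleared_coeff :: "complex \<Rightarrow> complex \<Rightarrow> complex \<Rightarrow> nat \<Rightarrow> nat \<Rightarrow> complex" where
  "cleared_coeff b c a M N = T (a * q ^ (2 * N)) / T a * (pp a N / pp (a * q ^ Suc M) N)
     * ((- a / (b * c)) ^ N * q ^ (N * M) / q ^ (N choose 2))
     * (pp b N * pp c N * pp (a * q ^ Suc N / b) (M - N) * pp (a * q ^ Suc N / c) (M - N))"

lemma cleared_coeff_eq:
  assumes "\<And>i. T (a * q ^ i) \<noteq> 0" "\<And>i. T (a * q ^ i / (b * c)) \<noteq> 0"
  shows "cleared_coeff b c a M N = pp (a * q) M * pp (a * q / (b * c)) M * coeff b c a M N"
proof -
  have pp_nz: "pp (a * q ^ j) k \<noteq> 0" "pp (a * q ^ j / (b * c)) k \<noteq> 0" for j k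
  proof -
    have "T (a * q ^ j * q ^ i) \<noteq> 0" "T (a * q ^ j / (b * c) * q ^ i) \<noteq> 0" for i
      using assms(1)[of "j + i"] assms(2)[of "j + i"] by (simp_all add: power_add mult.assoc)
    then show "pp (a * q ^ j) k \<noteq> 0" "pp (a * q ^ j / (b * c)) k \<noteq> 0"
      by (simp_all only: ell_fact_def prod_zero_iff finite_lessThan) simp_all
  qed
  \<comment> \<open>Both sides are the factorial of length \<open>N + M + 1\<close> starting at
    \<open>a\<close>, cut in two ways.\<close>
  have "pp a N * pp (a * q ^ N) (Suc M) = pp a (Suc M) * pp (a * q ^ Suc M) N"
    by (simp only: pp_add[symmetric] add.commute)
  also have "pp a (Suc M) = T a * pp (a * q) M"
    by (rule pp_Suc')
  finally have eq: "pp a N / (T a * pp (a * q ^ Suc M) N) = pp (a * q) M / pp (a * q ^ N) (Suc M)"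
    using assms(1)[of 0] pp_nz by (simp add: field_simps del: power_Suc)
  have "T (a * q ^ (2 * N)) / T a * (pp a N / pp (a * q ^ Suc M) N) = T (a * q ^ (2 * N)) * (pp (a
      * q) M / pp (a * q ^ N) (Suc M))"
    unfolding eq[symmetric] by simp
  then have "cleared_coeff b c a M N = T (a * q ^ (2 * N)) * (pp (a * q) M / pp (a * q ^ N) (Suc M))
     * ((- a / (b * c)) ^ N * q ^ (N * M) / q ^ (N choose 2))
     * (pp b N * pp c N * pp (a * q ^ Suc N / b) (M - N) * pp (a * q ^ Suc N / c) (M - N))"
    unfolding cleared_coeff_def by (rule arg_cong)
  then show ?thesis
    using pp_nz(2)[of 1 M] by (simp add: coeff_def del: power_Suc)
qed

theorem product_expansion:
  fixes x :: "'i \<Rightarrow> complex"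
  assumes X: "finite X" and nz: "a \<noteq> 0" "b \<noteq> 0" "c \<noteq> 0" "A \<noteq> 0" "B \<noteq> 0" and A: "A = B * (b * c)"
    and x: "\<And>i. i \<in> X \<Longrightarrow> x i \<noteq> 0"
    and a_nz: "T a \<noteq> 0" "\<And>N. N \<le> card X \<Longrightarrow> pp (a * q ^ Suc (card X)) N \<noteq> 0"
    and x_x: "\<And>i j. i \<in> X \<Longrightarrow> j \<in> X \<Longrightarrow> i \<noteq> j \<Longrightarrow> T (x i / x j) \<noteq> 0"
  shows "pp (a * q) (card X) * pp (a * q / (b * c)) (card X) * (\<Prod>i\<in>X. T (A / b * x i) * T (B * b
      * x i)) =
    (\<Sum>S\<in>Pow X. cleared_coeff b c a (card X) (card S) * subset_term x A B a X S)"
proof -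
  \<comment> \<open>The deformation keeps \<open>A = B * (b * c)\<close> and leaves
    \<open>b\<close>, \<open>c\<close> fixed. The square is there so that \<open>A / a\<close> moves
    as well: every theta value that must be nonzero then has an argument with a positive power of
    \<open>s\<close>.\<close>
  define F where "F s = pp (a * s * q) (card X) * pp (a * s * q / (b * c)) (card X)
      * (\<Prod>i\<in>X. T (A * s ^ 2 / b * x i) * T (B * s ^ 2 * b * x i))
    - (\<Sum>S\<in>Pow X. cleared_coeff b c (a * s) (card X) (card S) * subset_term x (A * s ^ 2) (B
        * s ^ 2) (a * s) X S)" for s
  define bad where "bad = {0} \<union> (\<Union>j. {s. T (a * q ^ j * s ^ 1) = 0}) \<union> (\<Union>j. {s. T (a * q ^ j / (b
      * c) * s ^ 1) = 0})
    \<union> (\<Union>i\<in>X. \<Union>N. {s. T (A / (a * q ^ N) * x i * s ^ 1) = 0}) \<union> (\<Union>i\<in>X. \<Union>N. {s. T (B / q ^ N * x i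
        * s ^ 2) = 0})"
  have "F 1 = 0"
  proof (rule eq_zero_if_zero_off_countable[where f = F and w = 1])
    have "isCont (\<lambda>s. pp (a * s * q) (card X)) 1" "isCont (\<lambda>s. pp (a * s * q / (b * c)) (card X)) 1"
      unfolding ell_fact_def using nz q_nz by (intro continuous_intros T_isCont; simp)+
    moreover have "isCont (\<lambda>s. \<Prod>i\<in>X. T (A * s ^ 2 / b * x i) * T (B * s ^ 2 * b * x i)) 1"
      using nz x by (intro continuous_intros T_isCont) auto
    moreover have "isCont (\<lambda>s. cleared_coeff b c (a * s) (card X) N) 1" if "N \<le> card X" for N
    proof -
      have pp: "isCont (\<lambda>s. pp (f s) k) 1" if "isCont f 1" "f 1 \<noteq> 0" for f k
        unfolding ell_fact_def using that q_nz by (intro continuous_intros T_isCont) auto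
      show ?thesis
        unfolding cleared_coeff_def using nz q_nz a_nz(1) a_nz(2)[OF that]
        by (intro continuous_intros T_isCont pp) simp_all
    qed
    moreover have "isCont (\<lambda>s. subset_term x (A * s ^ 2) (B * s ^ 2) (a
        * s) X S) 1" if "S \<subseteq> X" for S
      unfolding subset_term_def outer_factor_def inner_factor_def
      using nz x q_nz that by (intro continuous_intros T_isCont) auto
    ultimately show "isCont F 1"
      unfolding F_def using X
      by (intro continuous_diff continuous_mult continuous_sum) (auto intro: card_mono)
  next
    show "countable bad"
      unfolding bad_def using nz x q_nz X
      by (intro countable_Un countable_UN countable_T_zeros countable_finite[OF X]) auto
  next
    fix s assume s: "s \<notin> bad"
    then have s_nz: "s \<noteq> 0" by (simp add: bad_def)
    have gen: "T (a * s * q ^ j) \<noteq> 0" "T (a * s * q ^ j / (b * c)) \<noteq> 0" for j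
      using s by (auto simp: bad_def mult_ac)
    have gen': "T (A * s ^ 2 / (a * s * q ^ N) * x i) \<noteq> 0" "T (B * s ^ 2 / q ^ N * x i) \<noteq> 0" if "i
        \<in> X" for i N
    proof -
      have "T (A / (a * q ^ N) * x i * s ^ 1) \<noteq> 0" "T (B / q ^ N * x i * s ^ 2) \<noteq> 0"
        using s that by (auto simp: bad_def)
      moreover have "A * s ^ 2 / (a * s * q ^ N) * x i = A / (a * q ^ N) * x i * s ^ 1"
        "B * s ^ 2 / q ^ N * x i = B / q ^ N * x i * s ^ 2"
        using s_nz by (simp_all add: power2_eq_square)
      ultimately show "T (A * s ^ 2 / (a * s * q ^ N) * x i) \<noteq> 0" "T (B * s ^ 2 / q ^ N * x i) \<noteq> 0"
        by (simp_all only: not_False_eq_True)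
    qed
    have "(\<Prod>i\<in>X. T (A * s ^ 2 / b * x i) * T (B * s ^ 2 * b * x i)) =
      (\<Sum>S\<in>Pow X. coeff b c (a * s) (card X) (card S) * subset_term x (A * s ^ 2) (B * s ^ 2) (a
          * s) X S)"
    proof (rule product_expansion_generic[OF X])
      show "T (x i / x j) \<noteq> 0" if "i \<in> X" "j \<in> X" "i \<noteq> j" for i j
        by (rule x_x[OF that])
      show "T (a * s * q ^ i) \<noteq> 0" "T (a * s * q ^ i / (b * c)) \<noteq> 0" for i
        by (rule gen)+
      show "T (A * s ^ 2 / (a * s * q ^ N) * x i) \<noteq> 0" "T (B * s ^ 2 / q ^ N * x i) \<noteq> 0" if "i
          \<in> X" for i N
        by (rule gen'[OF that])+
    qed (use nz A x s_nz in \<open>auto simp: mult_ac\<close>)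
    then show "F s = 0"
      by (simp only: F_def cleared_coeff_eq[OF gen]) (simp add: sum_distrib_left mult_ac)
  qed
  then show ?thesis by (simp add: F_def)
qed


section \<open>Specialization to geometric progressions of points\<close>

lemma pp_reverse:
  assumes "u \<noteq> 0"
  shows "pp u m = (- u) ^ m * q ^ (m choose 2) * pp (q / (u * q ^ m)) m"
proof (induction m)
  case (Suc m)
  have "pp (q / (u * q ^ Suc m)) (Suc m) = T (1 / (u * q ^ m)) * pp (q / (u * q ^ m)) m"
    using q_nz by (simp add: pp_Suc')
  moreover have "T (1 / (u * q ^ m)) = - T (u * q ^ m) / (u * q ^ m)"
    using assms q_nz by (intro T_inverse) auto
  ultimately show ?case
    using Suc assms q_nz by (simp add: pp_Suc choose_two_Suc power_add)
qed (simp add: binomial_eq_0)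

lemma prod_theta_ratio:
  assumes "l \<le> m" and "\<And>s u. s < k \<Longrightarrow> l \<le> u \<Longrightarrow> u \<le> m \<Longrightarrow> T (\<alpha> * q ^ s / (\<beta> * q ^ u)) \<noteq> 0"
  shows "(\<Prod>s<k. \<Prod>u\<in>{l..<m}. theta_ratio (\<alpha> * q ^ s) (\<beta> * q ^ u)) =
    pp (\<alpha> / (\<beta> * q ^ m)) k / pp (\<alpha> / (\<beta> * q ^ l)) k"
proof -
  have "(\<Prod>u\<in>{l..<m}. theta_ratio (\<alpha> * q ^ s) (\<beta> * q ^ u)) =
      T (\<alpha> / (\<beta> * q ^ m) * q ^ s) / T (\<alpha> / (\<beta> * q ^ l) * q ^ s)" if "s < k" for s
    using assms(1) assms(2)[OF that]
  proof (induction m rule: dec_induct)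
    case base
    then show ?case using base[of l] by simp
  next
    case (step m)
    have "T (\<alpha> * q ^ s / (\<beta> * q ^ m)) \<noteq> 0" using step.prems[of m] step.hyps by simp
    with step show ?case by (simp add: theta_ratio_def mult_ac)
  qed
  then show ?thesis by (simp add: ell_fact_def prod_dividef)
qed

text \<open>The correction between the denominators left by telescoping and those of the theorem;
  its product over all \<open>i\<close>, \<open>j\<close> is the \<open>Delta\<close> quotient up to
  a sign and a power of \<open>q\<close>.\<close>

definition fact_ratio :: "(nat \<Rightarrow> complex) \<Rightarrow> (nat \<Rightarrow> nat) \<Rightarrow> nat \<Rightarrow> nat \<Rightarrow> complex" where
  "fact_ratio x k i j = pp (q * x i / x j) (k i) / pp (x i / (x j * q ^ k j)) (k i)"

lemma fact_ratio_diag: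
  assumes "x i \<noteq> 0" "pp q (k i) \<noteq> 0"
  shows "fact_ratio x k i i = (- 1) ^ k i * q ^ (Suc (k i) choose 2)"
proof -
  define m where "m = k i"
  have "pp (1 / q ^ m) m = (- (1 / q ^ m)) ^ m * q ^ (m choose 2) * pp q m"
    using q_nz pp_reverse[of "1 / q ^ m" m] by simp
  moreover have "q ^ (m * m) = q ^ (m choose 2) * q ^ (Suc m choose 2)"
    using power_two_choose_two[of m] by (simp add: power_add)
  moreover have "(- (1 / q ^ m)) ^ m = (- 1) ^ m / q ^ (m * m)"
    by (simp add: power_minus[of "1 / q ^ m"] power_mult power_divide)
  ultimately have "pp (1 / q ^ m) m = (- 1) ^ m / q ^ (Suc m choose 2) * pp q m"
    using q_nz by simp
  moreover have "v / (s / t * v) = s * t" if "s * s = 1" "v \<noteq> 0" "t \<noteq> 0" for s t v :: complex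
    using that inverse_unique[OF that(1)] by (simp add: divide_inverse)
  moreover have "((- 1) ^ m * (- 1) ^ m :: complex) = 1"
    by (simp only: power_mult_distrib[symmetric]) simp
  ultimately have "pp q m / pp (1 / q ^ m) m = (- 1) ^ m * q ^ (Suc m choose 2)"
    using q_nz assms(2) by (simp only: m_def) simp
  then show ?thesis
    using assms(1) by (simp add: fact_ratio_def m_def)
qed

text \<open>With \<open>y = x i / x j\<close>, \<open>m = k i\<close>, \<open>l = k j\<close>, after
  a reversal all four factorials are pieces of the string from \<open>y / q ^ l\<close> to
  \<open>y * q ^ m\<close>. Cutting it at \<open>T y\<close> and at
  \<open>T (y * q ^ m / q ^ l)\<close> leaves the quotient of these two.\<close>

lemma fact_ratio_pair:
  assumes nz: "x i \<noteq> 0" "x j \<noteq> 0"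
    and gen: "\<And>s u. s \<le> k i \<Longrightarrow> u \<le> k j \<Longrightarrow> T (x i * q ^ s / (x j * q ^ u)) \<noteq> 0"
  shows "fact_ratio x k i j * fact_ratio x k j i =
    q ^ (k i * k j) * (x j * q ^ k j * T (x i * q ^ k i / (x j * q ^ k j)) / (x j * T (x i / x j)))"
proof -
  define y m l where "y = x i / x j" and "m = k i" and "l = k j"
  have y: "y \<noteq> 0" "x j / x i = 1 / y" using nz by (simp_all add: y_def)
  have gen': "T (y * q ^ s / q ^ u) \<noteq> 0" if "s \<le> m" "u \<le> l" for s u
    using gen[of s u] that by (simp add: y_def m_def l_def)
  \<comment> \<open>No theta factor of the whole string vanishes: below \<open>y\<close> this uses
    \<open>s = 0\<close> in \<open>gen'\<close>, above it \<open>u = 0\<close>.\<close>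
  have gen_low: "T (y / q ^ l * q ^ s) \<noteq> 0" if "s \<le> l + m" for s
  proof (cases "s \<le> l")
    case True
    then have "y / q ^ l * q ^ s = y * q ^ 0 / q ^ (l - s)"
      using q_nz by (simp add: power_diff)
    then show ?thesis using gen'[of 0 "l - s"] by simp
  next
    case False
    then have "y / q ^ l * q ^ s = y * q ^ (s - l) / q ^ 0"
      using q_nz by (simp add: power_diff)
    then show ?thesis using gen'[of "s - l" 0] that by simp
  qed
  have pp_nz: "pp (y / q ^ l) m \<noteq> 0" "pp (y * q ^ Suc m / q ^ l) l \<noteq> 0"
  proof -
    have "pp (y / q ^ l) (Suc (l + m)) \<noteq> 0"
      using gen_low by (simp add: ell_fact_def del: prod.lessThan_Suc)
    moreover have "pp (y / q ^ l) (Suc (l + m)) = pp (y / q ^ l) (Suc m) * pp (y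
        * q ^ Suc m / q ^ l) l"
      using pp_add[of "y / q ^ l" "Suc m" l] by (simp add: add.commute)
    ultimately show "pp (y / q ^ l) m \<noteq> 0" "pp (y * q ^ Suc m / q ^ l) l \<noteq> 0"
      by (auto simp: pp_Suc)
  qed
  have split: "pp (y / q ^ l) l * T y * pp (q * y) m = pp (y / q ^ l) m * T (y * q ^ m / q ^ l)
      * pp (y * q ^ Suc m / q ^ l) l"
  proof -
    have "pp (y / q ^ l) (l + Suc m) = pp (y / q ^ l) l * (T y * pp (q * y) m)"
      unfolding pp_add pp_Suc' using q_nz by (simp add: mult.commute)
    moreover have "pp (y / q ^ l) (Suc m + l) = pp (y / q ^ l) m * T (y * q ^ m / q ^ l) * pp (y
        * q ^ Suc m / q ^ l) l"
      unfolding pp_add pp_Suc by simp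
    ultimately show ?thesis by (simp only: mult.assoc add.commute[of l "Suc m"])
  qed
  have num: "pp (q / y) l = (- (q / y)) ^ l * q ^ (l choose 2) * pp (y / q ^ l) l"
    using pp_reverse[of "q / y" l] y q_nz by simp
  have den: "pp (1 / (y * q ^ m)) l = (- (1 / (y * q ^ m))) ^ l * q ^ (l choose 2) * pp (y
      * q ^ Suc m / q ^ l) l"
    using pp_reverse[of "1 / (y * q ^ m)" l] y q_nz by (simp add: mult_ac)
  have coef: "(- (q / y)) ^ l = q ^ l * q ^ (m * l) * (- (1 / (y * q ^ m))) ^ l"
  proof -
    have "- (q / y) = q * q ^ m * (- (1 / (y * q ^ m)))" using q_nz by simp
    then show ?thesis by (simp only: power_mult_distrib power_mult[symmetric])
  qed
  have "fact_ratio x k i j * fact_ratio x k j i = pp (q * y) m / pp (y / q ^ l) m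
      * (pp (q / y) l / pp (1 / (y * q ^ m)) l)"
  proof -
    have "q * x i / x j = q * y" "x i / (x j * q ^ l) = y / q ^ l" "q * x j / x i = q / y"
      "x j / (x i * q ^ m) = 1 / (y * q ^ m)" using nz by (simp_all add: y_def)
    then show ?thesis by (simp only: fact_ratio_def m_def l_def)
  qed
  also have "\<dots> = q ^ l * q ^ (m * l) * (pp (y / q ^ l) l * pp (q * y) m / (pp (y / q ^ l) m * pp (y
      * q ^ Suc m / q ^ l) l))"
    unfolding num den coef using y q_nz by (simp add: mult_ac del: power_Suc)
  also have "pp (y / q ^ l) l * pp (q * y) m / (pp (y / q ^ l) m * pp (y * q ^ Suc m / q ^ l) l) =
     T (y * q ^ m / q ^ l) / T y"
    using split pp_nz gen'[of 0 0] by (simp add: field_simps del: power_Suc)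
  finally show ?thesis
    using nz by (simp add: y_def m_def l_def mult_ac)
qed

lemma prod_fact_ratio:
  assumes nz: "\<And>i. i \<in> {1..r} \<Longrightarrow> x i \<noteq> 0"
    and gen: "\<And>i j s u. i \<in> {1..r} \<Longrightarrow> j \<in> {1..r} \<Longrightarrow> i \<noteq> j \<Longrightarrow> s \<le> k i \<Longrightarrow> u \<le> k j \<Longrightarrow> T (x i * q ^ s / (x j
        * q ^ u)) \<noteq> 0"
    and diag: "\<And>i. i \<in> {1..r} \<Longrightarrow> pp q (k i) \<noteq> 0"
  shows "(\<Prod>i\<in>{1..r}. \<Prod>j\<in>{1..r}. fact_ratio x k i j) =
    (- 1) ^ vsum r k * q ^ (Suc (vsum r k) choose 2) * (Delta r (\<lambda>i. x i
        * q ^ k i) p / Delta r x p)"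
  using assms
proof (induction r)
  case 0
  then show ?case by (simp add: vsum_def Delta_def numeral_2_eq_2)
next
  case (Suc r)
  define w where "w = Suc r"
  define N where "N = vsum r k"
  define f where "f x i = x w * T (x i / x w)" for x :: "nat \<Rightarrow> complex" and i
  have ins: "{1..Suc r} = insert w {1..r}" "w \<notin> {1..r}" by (auto simp: w_def)
  have D: "Delta (Suc r) x p = (\<Prod>i\<in>{1..r}. f x i) * Delta r x p" for x
    unfolding Delta_def ins(1) f_def using ins(2) by (simp add: w_def
        atLeastLessThanSuc_atLeastAtMost)
  have V: "vsum (Suc r) k = N + k w"
    unfolding vsum_def ins(1) using ins(2) by (simp add: N_def vsum_def)
  have IH: "(\<Prod>i\<in>{1..r}. \<Prod>j\<in>{1..r}. fact_ratio x k i j) =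
    (- 1) ^ N * q ^ (Suc N choose 2) * (Delta r (\<lambda>i. x i * q ^ k i) p / Delta r x p)"
    unfolding N_def by (rule Suc.IH) (use Suc.prems in auto)
  have pair: "fact_ratio x k i w * fact_ratio x k w i = q ^ (k i * k w) * (f (\<lambda>i. x i
      * q ^ k i) i / f x i)" if "i \<in> {1..r}" for i
    unfolding f_def by (rule fact_ratio_pair) (use Suc.prems that in \<open>auto simp: w_def\<close>)
  have "(\<Prod>i\<in>{1..Suc r}. \<Prod>j\<in>{1..Suc r}. fact_ratio x k i j) =
      (\<Prod>i\<in>{1..r}. \<Prod>j\<in>{1..r}. fact_ratio x k i j) * (\<Prod>i\<in>{1..r}. fact_ratio x k i w
          * fact_ratio x k w i) * fact_ratio x k w w"
    unfolding ins(1) using ins(2) by (simp add: prod.distrib mult_ac)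
  also have "fact_ratio x k w w = (- 1) ^ k w * q ^ (Suc (k w) choose 2)"
    using Suc.prems by (intro fact_ratio_diag) (auto simp: w_def)
  also have "(\<Prod>i\<in>{1..r}. fact_ratio x k i w * fact_ratio x k w i) =
      q ^ (N * k w) * ((\<Prod>i\<in>{1..r}. f (\<lambda>i. x i * q ^ k i) i) / (\<Prod>i\<in>{1..r}. f x i))"
  proof -
    have "(\<Prod>i\<in>{1..r}. fact_ratio x k i w * fact_ratio x k w i) = (\<Prod>i\<in>{1..r}. q ^ (k i * k w)
        * (f (\<lambda>i. x i * q ^ k i) i / f x i))"
      by (rule prod.cong[OF refl pair])
    then show ?thesis
      by (simp add: prod.distrib prod_dividef power_sum[symmetric] sum_distrib_right[symmetric]
          N_def vsum_def)
  qed
  finally have *: "(\<Prod>i\<in>{1..Suc r}. \<Prod>j\<in>{1..Suc r}. fact_ratio x k i j) =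
     (- 1) ^ (N + k w) * (q ^ (Suc N choose 2) * q ^ (N * k w) * q ^ (Suc (k w) choose 2))
     * (Delta (Suc r) (\<lambda>i. x i * q ^ k i) p / Delta (Suc r) x p)"
    unfolding IH D by (simp add: power_add mult_ac)
  \<comment> \<open>The mixed terms \<open>q ^ (k i * k w)\<close> supply the exponent
    \<open>N * k w\<close> that completes the triangular number.\<close>
  have "q ^ (Suc N choose 2) * q ^ (N * k w) * q ^ (Suc (k w) choose 2) = q ^ (Suc (N
      + k w) choose 2)"
    unfolding power_add[symmetric] choose_two_Suc choose_two_add by (simp add: add_ac)
  then show ?case unfolding * V by simp
qed

text \<open>For \<open>e = b * c * d / a\<close> and \<open>u = x i\<close> this passes from the
  factors of the theorem belonging to \<open>i\<close> to those of \<open>subset_term\<close>, by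
  reversing the factorials whose argument has \<open>u\<close> in the denominator.\<close>

lemma factor_conversion:
  assumes nz: "d \<noteq> 0" "e \<noteq> 0" "u \<noteq> 0" and le: "k \<le> N" "k \<le> n"
    and pp_nz: "pp (d / u) (N - k) \<noteq> 0" "pp (e / (q ^ n * u)) N \<noteq> 0"
  shows "pp (e / u) (N - k) * pp (d / u) N / pp (d / u) (N - k) * pp (q / e * u) n / pp (e / (q ^ n
      * u)) N =
    (d / e) ^ k * q ^ (n * N) * pp (q / e * u * q ^ k / q ^ N) (n - k) * pp (q / d * u / q ^ N) k"
proof -
  obtain m h where N: "N = m + k" and n: "n = h + k"
    using le by (metis le_iff_add add.commute)
  define v where "v = q / e * u / q ^ m"
  have v: "v \<noteq> 0" using nz q_nz by (simp add: v_def)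
  have 1: "pp (d / u) N = pp (d / u) m * ((- (d * q ^ m / u)) ^ k * q ^ (k choose 2) * pp (q / d
      * u / q ^ N) k)"
  proof -
    have r: "q / (d / u * q ^ m * q ^ k) = q / d * u / q ^ N" "d / u * q ^ m = d * q ^ m / u"
      by (simp_all add: N power_add)
    have "pp (d / u * q ^ m) k = (- (d / u * q ^ m)) ^ k * q ^ (k choose 2) * pp (q / (d / u * q ^ m
        * q ^ k)) k"
      using nz q_nz by (intro pp_reverse) simp
    then have "pp (d / u * q ^ m) k = (- (d * q ^ m / u)) ^ k * q ^ (k choose 2) * pp (q / d
        * u / q ^ N) k"
      unfolding r(1) unfolding r(2) .
    moreover have "pp (d / u) N = pp (d / u) m * pp (d / u * q ^ m) k" by (simp add: N pp_add)
    ultimately show ?thesis by (simp only:)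
  qed
  have 2: "pp (e / u) m = (- (e / u)) ^ m * q ^ (m choose 2) * pp v m"
    using pp_reverse[of "e / u" m] nz by (simp add: v_def)
  have 3: "pp (e / (q ^ n * u)) N = (- (e / (q ^ n * u))) ^ N * q ^ (N choose 2) * pp (v * q ^ h) N"
  proof -
    have "q / (e / (q ^ n * u) * q ^ N) = v * q ^ h"
      using q_nz by (simp add: v_def N n power_add mult_ac)
    then show ?thesis using pp_reverse[of "e / (q ^ n * u)" N] nz q_nz by simp
  qed
  have 4: "pp v m * pp (q / e * u) n = pp v h * pp (v * q ^ h) N"
  proof -
    have "v * q ^ m = q / e * u" using q_nz by (simp add: v_def)
    then have "pp v (m + n) = pp v m * pp (q / e * u) n" by (simp add: pp_add)
    moreover have "m + n = h + N" by (simp add: N n)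
    ultimately show ?thesis by (simp add: pp_add)
  qed
  have 5: "q / e * u * q ^ k / q ^ N = v" using q_nz by (simp add: v_def N power_add)
  have coef: "(- (e / u)) ^ m * q ^ (m choose 2) * ((- (d * q ^ m / u)) ^ k * q ^ (k choose 2)) =
      (d / e) ^ k * q ^ (n * N) * ((- (e / (q ^ n * u))) ^ N * q ^ (N choose 2))"
  proof -
    have a1: "- (e / u) = q ^ n * - (e / (q ^ n * u))" using q_nz by simp
    have a2: "- (d * q ^ m / u) = d / e * q ^ m * (q ^ n * - (e / (q ^ n * u)))" using q_nz nz
        by simp
    have "N choose 2 = (m choose 2) + (k choose 2) + m * k" by (simp add: N choose_two_add)
    then have a3: "q ^ (N choose 2) = q ^ (m choose 2) * q ^ (k choose 2) * q ^ (m * k)"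
        by (simp add: power_add)
    show ?thesis
      unfolding a1 a2 a3 unfolding power_mult_distrib
          by (simp add: N power_add power_mult[symmetric] algebra_simps)
  qed
  have nz': "pp (v * q ^ h) N \<noteq> 0" "(- (e / (q ^ n * u))) ^ N
      * q ^ (N choose 2) \<noteq> 0" "pp (d / u) m \<noteq> 0"
    using pp_nz unfolding 3 by (auto simp: N)
  have sub: "N - k = m" "n - k = h" by (simp_all add: N n)
  define c1 c2 where "c1 = (- (e / u)) ^ m * q ^ (m choose 2) * ((- (d * q ^ m / u)) ^ k
      * q ^ (k choose 2))"
    and "c2 = (- (e / (q ^ n * u))) ^ N * q ^ (N choose 2)"
  have "pp (e / u) m * pp (d / u) N / pp (d / u) m * pp (q / e * u) n / pp (e / (q ^ n * u)) N =
    c1 * (pp v m * pp (q / e * u) n) * pp (q / d * u / q ^ N) k / (c2 * pp (v * q ^ h) N)"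
    unfolding 1 2 3 c1_def c2_def using nz'(3) by simp
  also have "\<dots> = c1 / c2 * pp v h * pp (q / d * u / q ^ N) k"
    unfolding 4 using nz'(1) by simp
  also have "c1 / c2 = (d / e) ^ k * q ^ (n * N)"
    using coef nz'(2) by (simp add: c1_def c2_def)
  finally show ?thesis unfolding sub 5 .
qed


lemma T_quot_eq_0_iff: "u \<noteq> 0 \<Longrightarrow> v \<noteq> 0 \<Longrightarrow> T (u / v) = 0 \<longleftrightarrow> T (v / u) = 0"
  using T_flip[of u v] by auto

lemma pp_eq_0_iff: "pp u k = 0 \<longleftrightarrow> (\<exists>j<k. T (u * q ^ j) = 0)"
  by (auto simp: ell_fact_def)

section \<open>Subsets of geometric progressions and their initial segments\<close>

definition tableau :: "nat \<Rightarrow> (nat \<Rightarrow> nat) \<Rightarrow> (nat \<times> nat) set" where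
  "tableau r k = (SIGMA i:{1..r}. {..<k i})"

definition point :: "(nat \<Rightarrow> complex) \<Rightarrow> nat \<times> nat \<Rightarrow> complex" where
  "point x = (\<lambda>(i, s). x i * q ^ s)"

lemma finite_tableau [simp]: "finite (tableau r k)"
  by (simp add: tableau_def)

lemma card_tableau: "card (tableau r k) = vsum r k"
  by (simp add: tableau_def vsum_def)

text \<open>A subset on which \<open>f\<close> may be nonzero has rows closed under predecessors.
  Each row is then an initial segment, and the row lengths form the multi-index.\<close>

lemma sum_Pow_tableau:
  assumes zero: "\<And>S i s. S \<subseteq> tableau r n \<Longrightarrow> (i, Suc s) \<in> S \<Longrightarrow> (i, s) \<notin> S \<Longrightarrow> f S = 0"
  shows "(\<Sum>S\<in>Pow (tableau r n). f S) = (\<Sum>k\<in>index_box r n. f (tableau r k))"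
proof -
  have inj: "inj_on (tableau r) (index_box r n)"
  proof (rule inj_onI)
    fix k k' assume k: "k \<in> index_box r n" "k' \<in> index_box r n" and eq: "tableau r k = tableau r k'"
    show "k = k'"
    proof (rule PiE_ext)
      fix i assume "i \<in> {1..r}"
      then have "{..<k i} = Pair i -` tableau r k" "{..<k' i} = Pair i -` tableau r k'"
        by (auto simp: tableau_def)
      then show "k i = k' i" unfolding eq by (metis lessThan_eq_iff)
    qed (use k in \<open>auto simp: index_box_def\<close>)
  qed
  have "(\<Sum>S\<in>Pow (tableau r n). f S) = (\<Sum>S\<in>tableau r ` index_box r n. f S)"
  proof (rule sum.mono_neutral_right)
    show "tableau r ` index_box r n \<subseteq> Pow (tableau r n)"
    proof (intro image_subsetI PowI subsetI)
      fix k v assume "k \<in> index_box r n" "v \<in> tableau r k"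
      then show "v \<in> tableau r n"
        by (auto simp: tableau_def index_box_def dest!: PiE_mem)
    qed
    show "\<forall>S\<in>Pow (tableau r n) - tableau r ` index_box r n. f S = 0"
    proof (intro ballI, rule ccontr)
      fix S assume S: "S \<in> Pow (tableau r n) - tableau r ` index_box r n" and "f S \<noteq> 0"
      then have down: "(i, s) \<in> S" if "(i, Suc s) \<in> S" for i s using zero that by blast
      define D where "D i = Pair i -` S" for i
      \<comment> \<open>\<open>index_box\<close> pins the entries outside \<open>{1..r}\<close>,
        hence the restriction.\<close>
      define k where "k = restrict (\<lambda>i. card (D i)) {1..r}"
      have D_sub: "D i \<subseteq> {..<n i}" for i using S by (auto simp: D_def tableau_def)
      have D_eq: "D i = {..<card (D i)}" for i
        using D_sub[of i] down by (intro finite_downset_eq_lessThan) (auto simp: D_def intro: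
            finite_subset)
      have mem: "(i, s) \<in> S \<longleftrightarrow> s < card (D i)" for i s
      proof -
        have "(i, s) \<in> S \<longleftrightarrow> s \<in> D i" by (simp add: D_def)
        then show ?thesis by (subst (asm) D_eq) simp
      qed
      have fst: "i \<in> {1..r}" if "(i, s) \<in> S" for i s
        using S that by (auto simp: tableau_def)
      have "v \<in> S \<longleftrightarrow> v \<in> tableau r k" for v
        using fst[of "fst v" "snd v"] mem[of "fst v" "snd v"]
        by (cases v) (auto simp: tableau_def k_def)
      then have "S = tableau r k" by blast
      moreover have "card (D i) \<le> n i" for i
        using card_mono[OF _ D_sub, of i] by simp
      then have "k \<in> index_box r n" by (auto simp: index_box_def k_def)
      ultimately show False using S by blast
    qed
  qed simp
  also have "\<dots> = (\<Sum>k\<in>index_box r n. f (tableau r k))"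
    using sum.reindex[OF inj] by simp
  finally show ?thesis .
qed

text \<open>The points of \<open>(i, s + 1)\<close> inside and \<open>(i, s)\<close> outside differ
  by the factor \<open>q\<close>, and their \<open>theta_ratio\<close> has numerator
  \<open>T 1\<close>.\<close>

lemma subset_term_tableau_eq_0:
  assumes "S \<subseteq> tableau r n" "(i, Suc s) \<in> S" "(i, s) \<notin> S" "x i \<noteq> 0"
  shows "subset_term (point x) A B a (tableau r n) S = 0"
proof -
  have "(i, s) \<in> tableau r n - S" using assms by (auto simp: tableau_def)
  moreover have "theta_ratio (point x (i, Suc s)) (point x (i, s)) = 0"
    using assms q_nz by (simp add: theta_ratio_def point_def)
  moreover have "finite S" using finite_subset[OF assms(1)] by simp
  ultimately have "(\<Prod>v\<in>S. \<Prod>w\<in>tableau r n - S. theta_ratio (point x v) (point x w)) = 0"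
    using assms(2) by (intro prod_zero bexI[of _ "(i, Suc s)"] bexI[of _ "(i, s)"]) auto
  then show ?thesis by (simp add: subset_term_def)
qed

lemma prod_shift: "(\<Prod>u\<in>{k..<m}. T (\<alpha> * q ^ u)) = pp (\<alpha> * q ^ k) (m - k)"
  by (simp add: prod.atLeastLessThan_shift_0[of _ k m] ell_fact_def lessThan_atLeast0 power_add
      mult_ac)

lemma subset_term_tableau:
  assumes k: "\<And>i. i \<in> {1..r} \<Longrightarrow> k i \<le> n i"
    and gen: "\<And>i j s u. i \<in> {1..r} \<Longrightarrow> j \<in> {1..r} \<Longrightarrow> s < n i \<Longrightarrow> u \<le> n j \<Longrightarrow> (i, s) \<noteq> (j, u) \<Longrightarrow>
      T (x i * q ^ s / (x j * q ^ u)) \<noteq> 0"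
  shows "subset_term (point x) A B a (tableau r n) (tableau r k) =
    (\<Prod>i\<in>{1..r}. \<Prod>j\<in>{1..r}. pp (x i / (x j * q ^ n j)) (k i) / pp (x i / (x j * q ^ k j)) (k i))
    * (\<Prod>i\<in>{1..r}. pp (A * x i * q ^ k i) (n i - k i) * pp (B / q ^ vsum r k * x i * q ^ k i) (n i
        - k i))
    * (\<Prod>i\<in>{1..r}. pp (A / (a * q ^ vsum r k) * x i) (k i) * pp (a * q ^ vsum r n * B * x i) (k i))"
proof -
  have diff: "tableau r n - tableau r k = (SIGMA i:{1..r}. {k i..<n i})"
    by (auto simp: tableau_def)
  have sigma: "(\<Prod>v\<in>(SIGMA i:{1..r}. D i). g v) = (\<Prod>i\<in>{1..r}. \<Prod>s\<in>D i. g (i, s))"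
    if "\<And>i. finite (D i)" for D :: "nat \<Rightarrow> nat set" and g :: "nat \<times> nat \<Rightarrow> complex"
    using that by (subst prod.Sigma) auto
  have "(\<Prod>v\<in>tableau r k. \<Prod>w\<in>tableau r n - tableau r k. theta_ratio (point x v) (point x w)) =
    (\<Prod>i\<in>{1..r}. \<Prod>s<k i. \<Prod>j\<in>{1..r}. \<Prod>u\<in>{k j..<n j}. theta_ratio (x i * q ^ s) (x j * q ^ u))"
    unfolding diff unfolding tableau_def
    by (simp only: sigma finite_lessThan finite_atLeastLessThan point_def prod.case)
  \<comment> \<open>The exchange puts the product over one row \<open>j\<close> innermost, where it
    telescopes.\<close>
  also have "\<dots> = (\<Prod>i\<in>{1..r}. \<Prod>j\<in>{1..r}. \<Prod>s<k i. \<Prod>u\<in>{k j..<n j}. theta_ratio (x i * q ^ s) (x j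
      * q ^ u))"
    by (rule prod.cong[OF refl], rule prod.swap)
  also have "\<dots> = (\<Prod>i\<in>{1..r}. \<Prod>j\<in>{1..r}. pp (x i / (x j * q ^ n j)) (k i) / pp (x i / (x j
      * q ^ k j)) (k i))"
  proof (intro prod.cong refl prod_theta_ratio)
    \<comment> \<open>Telescoping also meets \<open>u = n j\<close>, one place past the end of row
      \<open>j\<close>; hence \<open>u \<le> n j\<close> in \<open>gen\<close>.\<close>
    fix i j s u assume *: "i \<in> {1..r}" "j \<in> {1..r}" "s < k i" "k j \<le> u" "u \<le> n j"
    then have "(i, s) \<noteq> (j, u)" by auto
    then show "T (x i * q ^ s / (x j * q ^ u)) \<noteq> 0"
      using * k[of i] by (intro gen) auto
  qed (use k in auto)
  finally have 1: "(\<Prod>v\<in>tableau r k. \<Prod>w\<in>tableau r n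
      - tableau r k. theta_ratio (point x v) (point x w)) =
    (\<Prod>i\<in>{1..r}. \<Prod>j\<in>{1..r}. pp (x i / (x j * q ^ n j)) (k i) / pp (x i / (x j * q ^ k j)) (k i))" .
  have 2: "(\<Prod>w\<in>tableau r n - tableau r k. outer_factor A B N (point x w)) =
    (\<Prod>i\<in>{1..r}. pp (A * x i * q ^ k i) (n i - k i) * pp (B / q ^ N * x i * q ^ k i) (n i
        - k i))" for N
    unfolding diff
    by (simp only: sigma finite_atLeastLessThan point_def outer_factor_def prod.case
        mult.assoc[symmetric] prod.distrib prod_shift)
  have 3: "(\<Prod>v\<in>tableau r k. inner_factor A B a M N (point x v)) =
    (\<Prod>i\<in>{1..r}. pp (A / (a * q ^ N) * x i) (k i) * pp (a * q ^ M * B * x i) (k i))" for M N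
    unfolding tableau_def
    by (simp only: sigma finite_lessThan point_def inner_factor_def prod.case mult.assoc[symmetric]
        prod.distrib ell_fact_def)
  show ?thesis
    by (simp only: subset_term_def 1 2 3 card_tableau)
qed

end

section \<open>The summation formula\<close>

theorem theorem4p1:
  fixes p q a b c d :: complex and x :: "nat \<Rightarrow> complex" and r :: nat and n :: "nat \<Rightarrow> nat"
  assumes p: "norm p < 1"
    and q: "q \<noteq> 0"
    and q_generic: "\<And>(k::nat) (m::int). k > 0 \<Longrightarrow> q ^ k \<noteq> p powi m"
    and r: "r \<ge> 1"
    and nonzero: "a \<noteq> 0" "b \<noteq> 0" "c \<noteq> 0" "d \<noteq> 0" "\<And>i. i \<in> {1..r} \<Longrightarrow> x i \<noteq> 0"
    and Delta_nz: "Delta r x p \<noteq> 0"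
    and theta_a_nz: "theta a p \<noteq> 0"
    and lhs_nz: "\<And>k. k \<in> index_box r n \<Longrightarrow>
       ell_facts [a * q ^ (vsum r n + 1), a * q / b, a * q / c] q p (vsum r k) \<noteq> 0"
      "\<And>k i j. k \<in> index_box r n \<Longrightarrow> i \<in> {1..r} \<Longrightarrow> j \<in> {1..r} \<Longrightarrow>
       ell_fact (q * x i / x j) q p (k i) \<noteq> 0"
      "\<And>k i. k \<in> index_box r n \<Longrightarrow> i \<in> {1..r} \<Longrightarrow>
       ell_fact (d / x i) q p (vsum r k - k i) \<noteq> 0"
      "\<And>k i. k \<in> index_box r n \<Longrightarrow> i \<in> {1..r} \<Longrightarrow>
       ell_fact (b * c * d * q powi (- int (n i)) / (a * x i)) q p (vsum r k) \<noteq> 0"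
      "\<And>k i. k \<in> index_box r n \<Longrightarrow> i \<in> {1..r} \<Longrightarrow>
       ell_fact (a * x i * q / d) q p (k i) \<noteq> 0"
    and rhs_nz: "ell_facts [a * q / b, a * q / c] q p (vsum r n) \<noteq> 0"
      "\<And>i. i \<in> {1..r} \<Longrightarrow>
       ell_facts [a * x i * q / d, a * x i * q / (b * c * d)] q p (n i) \<noteq> 0"
  shows "(\<Sum>k\<in>index_box r n.
      Delta r (\<lambda>i. x i * q ^ k i) p / Delta r x p
      * (theta (a * q ^ (2 * vsum r k)) p / theta a p)
      * (ell_facts [a, b, c] q p (vsum r k)
         / ell_facts [a * q ^ (vsum r n + 1), a * q / b, a * q / c] q p (vsum r k))
      * q ^ vsum r k
      * (\<Prod>i\<in>{1..r}. \<Prod>j\<in>{1..r}.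
           ell_fact (q powi (- int (n j)) * x i / x j) q p (k i)
           / ell_fact (q * x i / x j) q p (k i))
      * (\<Prod>i\<in>{1..r}.
           (ell_fact (b * c * d / (a * x i)) q p (vsum r k - k i)
            * ell_fact (d / x i) q p (vsum r k)
            * ell_fact (a ^ 2 * x i * q ^ (vsum r n + 1) / (b * c * d)) q p (k i))
           / (ell_fact (d / x i) q p (vsum r k - k i)
              * ell_fact (b * c * d * q powi (- int (n i)) / (a * x i)) q p (vsum r k)
              * ell_fact (a * x i * q / d) q p (k i))))
    = ell_facts [a * q, a * q / (b * c)] q p (vsum r n)
        / ell_facts [a * q / b, a * q / c] q p (vsum r n)
      * (\<Prod>i\<in>{1..r}.
           ell_facts [a * x i * q / (b * d), a * x i * q / (c * d)] q p (n i)
           / ell_facts [a * x i * q / d, a * x i * q / (b * c * d)] q p (n i))"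
proof -
  interpret elliptic p q
    using p q by unfold_locales
  define M K e A B where "M = vsum r n" and "K = b * c" and "e = b * c * d / a"
    and "A = a * q / d" and "B = a * q / (b * c * d)"
  have nz: "K \<noteq> 0" "e \<noteq> 0" "A \<noteq> 0" "B \<noteq> 0" "A = B * (b * c)"
    using nonzero q by (simp_all add: K_def e_def A_def B_def)
  \<comment> \<open>The top corner of the box. The denominators of its term contain those of the
    smaller multi-indices needed below.\<close>
  define nn where "nn = restrict n {1..r}"
  have nn: "nn \<in> index_box r n" "vsum r nn = M" "\<And>i. i \<in> {1..r} \<Longrightarrow> nn i = n i"
    by (auto simp: nn_def index_box_def vsum_def M_def)
  have T_q: "T (q ^ Suc m) \<noteq> 0" for m
    using q q_generic[of "Suc m"] by (intro T_nz_power) auto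
  \<comment> \<open>The factor with index \<open>s - u - 1\<close> of the denominator
    \<open>pp (q * x i / x j) (n i)\<close>; \<open>i = j\<close> is allowed. Equal exponents are
    covered by \<open>Delta\<close>, and \<open>u > s\<close> by inversion.\<close>
  have off_diag: "T (x i * q ^ s / (x j * q ^ u)) \<noteq> 0"
    if "i \<in> {1..r}" "j \<in> {1..r}" "u < s" "s \<le> n i" for i j s u
  proof -
    have "pp (q * x i / x j) (n i) \<noteq> 0" using lhs_nz(2)[OF nn(1) that(1,2)] nn(3)[OF that(1)]
        by simp
    then have "T (q * x i / x j * q ^ (s - Suc u)) \<noteq> 0" using that by (auto simp: pp_eq_0_iff)
    moreover have "q ^ s = q * q ^ (s - Suc u) * q ^ u"
      using that(3) by (simp flip: power_Suc power_add)
    ultimately show ?thesis using q by (simp add: mult_ac)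
  qed
  have same: "T (x i / x j) \<noteq> 0" if "i \<in> {1..r}" "j \<in> {1..r}" "i < j" for i j
    using Delta_nz that by (auto simp: Delta_def)
  have x_x: "T (x i * q ^ s / (x j * q ^ u)) \<noteq> 0"
    if "i \<in> {1..r}" "j \<in> {1..r}" "(i, s) \<noteq> (j, u)" "s \<le> n i" "u \<le> n j" for i j s u
  proof -
    have swap: "T (x i * q ^ s / (x j * q ^ u)) = 0 \<longleftrightarrow> T (x j * q ^ u / (x i * q ^ s)) = 0"
      using nonzero(5) that q by (intro T_quot_eq_0_iff) auto
    consider "u < s" | "s < u" | "s = u" "i < j" | "s = u" "j < i"
      using \<open>(i, s) \<noteq> (j, u)\<close> by (metis linorder_neqE_nat)
    then show ?thesis
    proof cases
      case 1
      then show ?thesis using off_diag that by blast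
    next
      case 2
      then show ?thesis unfolding swap using off_diag that by blast
    next
      case 3
      then show ?thesis using same[OF that(1,2)] q by simp
    next
      case 4
      then show ?thesis unfolding swap using same[OF that(2,1)] q by simp
    qed
  qed
  have aM: "pp (a * q ^ Suc M) N \<noteq> 0" if "N \<le> M" for N
  proof -
    have "pp (a * q ^ Suc M) M \<noteq> 0" using lhs_nz(1)[OF nn(1)]
        by (simp add: ell_facts_def nn(2) M_def)
    then show ?thesis using that by (auto simp: pp_eq_0_iff)
  qed
  have points: "point x v \<noteq> 0" "\<And>w. w \<in> tableau r n \<Longrightarrow> v \<noteq> w \<Longrightarrow> T (point x v / point x w) \<noteq> 0"
    if "v \<in> tableau r n" for v
  proof -
    show "point x v \<noteq> 0" using that nonzero(5) q by (auto simp: tableau_def point_def)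
    fix w assume "w \<in> tableau r n" "v \<noteq> w"
    with that show "T (point x v / point x w) \<noteq> 0"
      using x_x[of "fst v" "fst w" "snd v" "snd w"]
      by (cases v; cases w) (auto simp: tableau_def point_def)
  qed
  have expansion: "pp (a * q) M * pp (a * q / (b * c)) M
      * (\<Prod>v\<in>tableau r n. T (A / b * point x v) * T (B * b * point x v)) =
    (\<Sum>S\<in>Pow (tableau r n). cleared_coeff b c a M (card S)
        * subset_term (point x) A B a (tableau r n) S)"
    unfolding M_def card_tableau[symmetric]
    by (rule product_expansion)
      (use nonzero(1-3) nz points theta_a_nz aM in \<open>auto simp: card_tableau M_def\<close>)
  have product: "(\<Prod>v\<in>tableau r n. T (A / b * point x v) * T (B * b * point x v)) =
    (\<Prod>i\<in>{1..r}. pp (a * x i * q / (b * d)) (n i) * pp (a * x i * q / (c * d)) (n i))"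
  proof -
    have "(\<Prod>v\<in>tableau r n. T (A / b * point x v) * T (B * b * point x v)) =
      (\<Prod>i\<in>{1..r}. \<Prod>s<n i. T (A / b * (x i * q ^ s)) * T (B * b * (x i * q ^ s)))"
      unfolding tableau_def by (subst prod.Sigma) (auto simp: point_def intro!: prod.cong)
    moreover have "A / b * (x i * q ^ s) = a * x i * q / (b * d) * q ^ s"
      "B * b * (x i * q ^ s) = a * x i * q / (c * d) * q ^ s" for i s
      using nonzero by (simp_all add: A_def B_def mult_ac)
    ultimately show ?thesis by (simp only: ell_fact_def prod.distrib)
  qed
  \<comment> \<open>The denominator of the right-hand side, since
    \<open>A * x i = a * x i * q / d\<close> and
    \<open>B * x i = a * x i * q / (b * c * d)\<close>.\<close>
  define den where "den = pp (a * q / b) M * pp (a * q / c) M * (\<Prod>i\<in>{1..r}. pp (A * x i) (n i)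
      * pp (B * x i) (n i))"
  have AB_nz: "pp (A * x i) (n i) \<noteq> 0" "pp (B * x i) (n i) \<noteq> 0" if "i \<in> {1..r}" for i
    using rhs_nz(2)[OF that] by (simp_all add: ell_facts_def A_def B_def mult_ac)
  have den_nz: "den \<noteq> 0"
    using rhs_nz(1) AB_nz by (simp add: den_def ell_facts_def M_def)
  \<comment> \<open>\<open>target\<close> collects the factors of the theorem belonging to
    \<open>i\<close>, \<open>rest\<close> those of \<open>subset_term\<close> other than the
    interactions.\<close>
  define target where "target N k i = (pp (e / x i) (N - k) * pp (d / x i) N * pp (a * q ^ M * B
      * x i) k)
      / (pp (d / x i) (N - k) * pp (e / (q ^ n i * x i)) N * pp (A * x i) k)" for N k i
  define rest where "rest N k i = pp (A * x i * q ^ k) (n i - k) * pp (B / q ^ N * x i * q ^ k) (n i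
      - k)
      * (pp (A / (a * q ^ N) * x i) k * pp (a * q ^ M * B * x i) k)" for N k i
  define t where "t k = Delta r (\<lambda>i. x i * q ^ k i) p / Delta r x p
      * (theta (a * q ^ (2 * vsum r k)) p / theta a p)
      * (ell_facts [a, b, c] q p (vsum r k)
         / ell_facts [a * q ^ (vsum r n + 1), a * q / b, a * q / c] q p (vsum r k))
      * q ^ vsum r k
      * (\<Prod>i\<in>{1..r}. \<Prod>j\<in>{1..r}.
           ell_fact (q powi (- int (n j)) * x i / x j) q p (k i)
           / ell_fact (q * x i / x j) q p (k i))
      * (\<Prod>i\<in>{1..r}.
           (ell_fact (b * c * d / (a * x i)) q p (vsum r k - k i)
            * ell_fact (d / x i) q p (vsum r k)
            * ell_fact (a ^ 2 * x i * q ^ (vsum r n + 1) / (b * c * d)) q p (k i))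
           / (ell_fact (d / x i) q p (vsum r k - k i)
              * ell_fact (b * c * d * q powi (- int (n i)) / (a * x i)) q p (vsum r k)
              * ell_fact (a * x i * q / d) q p (k i)))" for k
  have t: "t k * den = cleared_coeff b c a M (vsum r k)
      * subset_term (point x) A B a (tableau r n) (tableau r k)"
    if k: "k \<in> index_box r n" for k
  proof -
    define N where "N = vsum r k"
    define D where "D = Delta r (\<lambda>i. x i * q ^ k i) p / Delta r x p"
    define P where "P = (\<Prod>i\<in>{1..r}. \<Prod>j\<in>{1..r}. pp (x i / (x j * q ^ n j)) (k i) / pp (q
        * x i / x j) (k i))"
    have k_le: "k i \<le> n i" if "i \<in> {1..r}" for i
      using k that by (auto simp: index_box_def dest: PiE_mem)
    have k_N: "k i \<le> N" if "i \<in> {1..r}" for i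
      unfolding N_def vsum_def using that by (intro member_le_sum) auto
    have N_M: "N \<le> M"
      unfolding N_def M_def vsum_def using k_le by (intro sum_mono)
    have shape: "b * c * d / (a * x i) = e / x i" "a\<^sup>2 * x i * q ^ (M + 1) / (b * c * d) = a * q ^ M
        * B * x i"
      "b * c * d * q powi (- int (n i)) / (a * x i) = e / (q ^ n i * x i)" "a * x i * q / d = A
          * x i"
      "q powi (- int (n j)) * x i / x j = x i / (x j * q ^ n j)" for i j
      by (simp_all add: e_def A_def B_def power_int_minus field_simps power2_eq_square)
    have t_eq: "t k = D * (T (a * q ^ (2 * N)) / T a)
      * (pp a N * pp b N * pp c N / (pp (a * q ^ Suc M) N * pp (a * q / b) N * pp (a * q / c) N))
      * q ^ N * P * (\<Prod>i\<in>{1..r}. target N (k i) i)"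
      unfolding t_def N_def[symmetric] M_def[symmetric] shape
      by (simp add: D_def P_def target_def ell_facts_def mult_ac)
    \<comment> \<open>Exchanging the denominators of the interaction product for those of the
      theorem is what brings in the \<open>Delta\<close> quotient \<open>D\<close>.\<close>
    have W: "(\<Prod>i\<in>{1..r}. \<Prod>j\<in>{1..r}. pp (x i / (x j * q ^ n j)) (k i) / pp (x i / (x j
        * q ^ k j)) (k i)) =
       P * ((- 1) ^ N * q ^ (Suc N choose 2) * D)"
    proof -
      have "P * (\<Prod>i\<in>{1..r}. \<Prod>j\<in>{1..r}. fact_ratio x k i j) =
        (\<Prod>i\<in>{1..r}. \<Prod>j\<in>{1..r}. pp (x i / (x j * q ^ n j)) (k i) / pp (x i / (x j * q ^ k j)) (k i))"
        unfolding P_def prod.distrib[symmetric]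
        using lhs_nz(2)[OF k] by (intro prod.cong refl) (simp add: fact_ratio_def)
      moreover have "(\<Prod>i\<in>{1..r}. \<Prod>j\<in>{1..r}. fact_ratio x k i j) = (- 1) ^ N * q ^ (Suc N choose 2)
          * D"
        unfolding N_def D_def
      proof (rule prod_fact_ratio)
        fix i j s u assume *: "i \<in> {1..r}" "j \<in> {1..r}" "i \<noteq> j" "s \<le> k i" "u \<le> k j"
        then show "T (x i * q ^ s / (x j * q ^ u)) \<noteq> 0"
          using k_le[of i] k_le[of j] by (intro x_x) auto
      next
        fix i assume "i \<in> {1..r}"
        then show "pp q (k i) \<noteq> 0" using lhs_nz(2)[OF k, of i i] nonzero(5) by simp
      qed (use nonzero(5) in auto)
      ultimately show ?thesis by simp
    qed
    have factor: "target N (k i) i * (pp (A * x i) (n i) * pp (B * x i) (n i)) =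
      (a / K) ^ k i * q ^ (n i * N) * rest N (k i) i" if i: "i \<in> {1..r}" for i
    proof -
      have AB: "q / e * x i = B * x i" "q / d * x i / q ^ N = A / (a * q ^ N) * x i"
          "q / e * x i * q ^ k i / q ^ N = B / q ^ N * x i * q ^ k i" "d / e = a / K"
        using nonzero by (simp_all add: e_def A_def B_def K_def)
      have A_split: "pp (A * x i) (n i) = pp (A * x i) (k i) * pp (A * x i * q ^ k i) (n i - k i)"
        using pp_add[of "A * x i" "k i" "n i - k i"] k_le[OF i] by simp
      have nz1: "pp (d / x i) (N - k i) \<noteq> 0" "pp (e / (q ^ n i * x i)) N \<noteq> 0" "pp (A
          * x i) (k i) \<noteq> 0"
        using lhs_nz(3-5)[OF k i] by (simp_all only: shape N_def not_False_eq_True)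
      have "pp (e / x i) (N - k i) * pp (d / x i) N / pp (d / x i) (N - k i) * pp (B
          * x i) (n i) / pp (e / (q ^ n i * x i)) N =
        (a / K) ^ k i * q ^ (n i * N) * pp (B / q ^ N * x i * q ^ k i) (n i - k i) * pp (A / (a
            * q ^ N) * x i) (k i)"
        using factor_conversion[of d e "x i" "k i" N "n i"] nonzero nz i k_N[OF i] k_le[OF i] nz1
        by (simp only: AB) simp
      moreover have "target N (k i) i * (pp (A * x i) (n i) * pp (B * x i) (n i)) =
        (pp (e / x i) (N - k i) * pp (d / x i) N / pp (d / x i) (N - k i) * pp (B
            * x i) (n i) / pp (e / (q ^ n i * x i)) N)
          * (pp (A * x i * q ^ k i) (n i - k i) * pp (a * q ^ M * B * x i) (k i))"
        unfolding target_def A_split using nz1(3) by simp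
      ultimately show ?thesis by (simp add: rest_def mult_ac)
    qed
    have factors: "(\<Prod>i\<in>{1..r}. target N (k i) i) * (\<Prod>i\<in>{1..r}. pp (A * x i) (n i) * pp (B
        * x i) (n i)) =
      (a / K) ^ N * q ^ (N * M) * (\<Prod>i\<in>{1..r}. rest N (k i) i)"
    proof -
      have "(\<Prod>i\<in>{1..r}. target N (k i) i) * (\<Prod>i\<in>{1..r}. pp (A * x i) (n i) * pp (B * x i) (n i)) =
        (\<Prod>i\<in>{1..r}. (a / K) ^ k i * q ^ (n i * N) * rest N (k i) i)"
        unfolding prod.distrib[symmetric, of "\<lambda>i. target N (k i) i"]
            by (intro prod.cong refl factor)
      also have "\<dots> = (a / K) ^ (\<Sum>i\<in>{1..r}. k i) * q ^ (\<Sum>i\<in>{1..r}. n i * N)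
          * (\<Prod>i\<in>{1..r}. rest N (k i) i)"
        by (simp only: prod.distrib power_sum)
      also have "(\<Sum>i\<in>{1..r}. k i) = N" by (simp add: N_def vsum_def)
      also have "(\<Sum>i\<in>{1..r}. n i * N) = N * M"
          by (simp add: M_def vsum_def sum_distrib_left mult.commute)
      finally show ?thesis .
    qed
    have split: "pp (a * q / f) M = pp (a * q / f) N * pp (a * q ^ Suc N / f) (M - N)" for f
      using pp_add[of "a * q / f" N "M - N"] N_M by (simp add: mult_ac)
    have qbc_nz: "pp (a * q / b) N \<noteq> 0" "pp (a * q / c) N \<noteq> 0"
      using lhs_nz(1)[OF k] by (simp_all add: ell_facts_def N_def)
    \<comment> \<open>The signs of \<open>cleared_coeff\<close> and \<open>prod_fact_ratio\<close>
      cancel, and the quotient of their powers with exponents \<open>Suc N choose 2\<close> and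
      \<open>N choose 2\<close> is the factor \<open>q ^ N\<close> of the theorem.\<close>
    have sign: "(- a / K) ^ N * q ^ (N * M) / q ^ (N choose 2) * ((- 1) ^ N
        * q ^ (Suc N choose 2)) =
      (a / K) ^ N * q ^ (N * M) * q ^ N"
    proof -
      have "- a / K = a / K * - 1" by simp
      then have "(- a / K) ^ N = (a / K) ^ N * (- 1) ^ N" by (simp only: power_mult_distrib)
      moreover have "((- 1) ^ N * (- 1) ^ N :: complex) = 1"
        by (simp only: power_mult_distrib[symmetric]) simp
      ultimately show ?thesis using q by (simp add: choose_two_Suc power_add)
    qed
    have "t k * den = D * (T (a * q ^ (2 * N)) / T a)
      * (pp a N * pp b N * pp c N / pp (a * q ^ Suc M) N) * (pp (a * q ^ Suc N / b) (M - N) * pp (a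
          * q ^ Suc N / c) (M - N))
      * q ^ N * P * ((\<Prod>i\<in>{1..r}. target N (k i) i) * (\<Prod>i\<in>{1..r}. pp (A * x i) (n i) * pp (B
          * x i) (n i)))"
      unfolding t_eq den_def split using qbc_nz by (simp add: mult_ac del: power_Suc)
    also have "\<dots> = D * (T (a * q ^ (2 * N)) / T a)
      * (pp a N * pp b N * pp c N / pp (a * q ^ Suc M) N) * (pp (a * q ^ Suc N / b) (M - N) * pp (a
          * q ^ Suc N / c) (M - N))
      * P * (\<Prod>i\<in>{1..r}. rest N (k i) i) * ((a / K) ^ N * q ^ (N * M) * q ^ N)"
      unfolding factors by (simp add: mult_ac del: power_Suc)
    also have "\<dots> = cleared_coeff b c a M N * (P * ((- 1) ^ N * q ^ (Suc N choose 2) * D)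
        * (\<Prod>i\<in>{1..r}. rest N (k i) i))"
      unfolding sign[symmetric] unfolding cleared_coeff_def K_def
          by (simp add: mult_ac del: power_Suc)
    also have "P * ((- 1) ^ N * q ^ (Suc N choose 2) * D) * (\<Prod>i\<in>{1..r}. rest N (k i) i) =
      subset_term (point x) A B a (tableau r n) (tableau r k)"
    proof -
      have "subset_term (point x) A B a (tableau r n) (tableau r k) =
        (\<Prod>i\<in>{1..r}. \<Prod>j\<in>{1..r}. pp (x i / (x j * q ^ n j)) (k i) / pp (x i / (x j * q ^ k j)) (k i))
        * (\<Prod>i\<in>{1..r}. pp (A * x i * q ^ k i) (n i - k i) * pp (B / q ^ N * x i * q ^ k i) (n i
            - k i))
        * (\<Prod>i\<in>{1..r}. pp (A / (a * q ^ N) * x i) (k i) * pp (a * q ^ M * B * x i) (k i))"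
        unfolding N_def M_def by (rule subset_term_tableau) (use k_le x_x in auto)
      then show ?thesis unfolding W rest_def prod.distrib[of "\<lambda>i. _ i * _ i" "\<lambda>i. _ i * _ i"]
        by (simp only: mult.assoc prod.distrib)
    qed
    finally show ?thesis unfolding N_def .
  qed
  have "(\<Sum>k\<in>index_box r n. t k) * den =
    (\<Sum>k\<in>index_box r n. cleared_coeff b c a M (vsum r k)
        * subset_term (point x) A B a (tableau r n) (tableau r k))"
    unfolding sum_distrib_right by (intro sum.cong refl t)
  also have "\<dots> = (\<Sum>S\<in>Pow (tableau r n). cleared_coeff b c a M (card S)
      * subset_term (point x) A B a (tableau r n) S)"
  proof (subst sum_Pow_tableau)
    fix S i s assume S: "S \<subseteq> tableau r n" "(i, Suc s) \<in> S" "(i, s) \<notin> S"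
    then have "x i \<noteq> 0" using nonzero(5) by (auto simp: tableau_def)
    with S show "cleared_coeff b c a M (card S) * subset_term (point x) A B a (tableau r n) S = 0"
      by (simp add: subset_term_tableau_eq_0)
  qed (simp add: card_tableau)
  also have "\<dots> = pp (a * q) M * pp (a * q / (b * c)) M
      * (\<Prod>i\<in>{1..r}. pp (a * x i * q / (b * d)) (n i) * pp (a * x i * q / (c * d)) (n i))"
    unfolding expansion[symmetric] product ..
  finally have "(\<Sum>k\<in>index_box r n. t k) = pp (a * q) M * pp (a * q / (b * c)) M
      * (\<Prod>i\<in>{1..r}. pp (a * x i * q / (b * d)) (n i) * pp (a * x i * q / (c * d)) (n i)) / den"
    using den_nz by (simp add: eq_divide_eq)
  also have "\<dots> = ell_facts [a * q, a * q / (b * c)] q p (vsum r n)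
        / ell_facts [a * q / b, a * q / c] q p (vsum r n)
      * (\<Prod>i\<in>{1..r}.
           ell_facts [a * x i * q / (b * d), a * x i * q / (c * d)] q p (n i)
           / ell_facts [a * x i * q / d, a * x i * q / (b * c * d)] q p (n i))"
  proof -
    have "a * x i * q / d = A * x i" "a * x i * q / (b * c * d) = B * x i" for i
      by (simp_all add: A_def B_def)
    then show ?thesis
      by (simp add: ell_facts_def den_def M_def prod_dividef)
  qed
  finally show ?thesis unfolding t_def .
qed

end
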